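(* Let $X$ and $Y$ be uniformly locally finite metric spaces and assume that all the sparse subspaces of $Y$ yield only compact ghost projections. (1) If there exists an injective coarse map $X\to Y$, then $\mathrm{C}^*_u(X)$ embeds into $\mathrm{C}^*_u(Y)$. (2) If $\mathrm{C}^*_u(X)$ embeds into $\mathrm{C}^*_u(Y)$ by a compact preserving map, then there are $k\geq 1$ and a partition $X=\bigsqcup_{n=1}^k X_n$ such that for every $n\in\{1,\ldots,k\}$ there exists an injective coarse map $X_n\to Y$.
   Context: A metric space $(X,d)$ is uniformly locally finite (u.l.f.) if $\sup_{x\in X}|B_r(x)|<\infty$ for all $r>0$. Let $(\delta_x)_{x\in X}$ be the canonical basis of $\ell_2(X)$. An operator $a\in\mathcal{B}(\ell_2(X))$ has finite propagation if there is $r>0$ with $\langle a\delta_x,\delta_y\rangle=0$ whenever $d(x,y)>r$. The uniform Roe algebra $\mathrm{C}^*_u(X)$ is the norm closure in $\mathcal{B}(\ell_2(X))$ of the set of finite propagation operators. An operator $a\in\mathcal{B}(\ell_2(X))$ is a ghost if for all $\varepsilon>0$ there is a finite $A\subseteq X$ such that $|\langle a\delta_x,\delta_y\rangle|<\varepsilon$ for all $x,y\in X\setminus A$. The space $X$ yields only compact ghost projections if every ghost projection in $\mathrm{C}^*_u(X)$ is compact. The space $X$ is sparse if there is a partition $X=\bigsqcup_{n\in\mathbb{N}}X_n$ into finite subsets with $d(X_n,X_m)\to\infty$ as $n+m\to\infty$ ($n\neq m$). A sparse subspace of $Y$ is a subset of $Y$ which is sparse in the restricted metric. A map $f\colon (X,d)\to(Y,\partial)$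 is coarse if $\sup\{\partial(f(x),f(y))\mid d(x,y)\leq r\}<\infty$ for all $r>0$. An embedding $\Phi\colon\mathrm{C}^*_u(X)\to\mathrm{C}^*_u(Y)$ is an injective $^*$-homomorphism (not necessarily unital). A map $\Phi$ is compact preserving if $\Phi(a)$ is compact for every compact $a\in\mathrm{C}^*_u(X)$. Subsets of $X$ carry the restricted metric. *)

theory Defs
  imports "HOL-Analysis.Analysis"
begin

section \<open>The Hilbert space of square-summable functions\<close>

typedef 'a ell2 = "{f :: 'a \<Rightarrow> complex. (\<lambda>x. (cmod (f x))\<^sup>2) summable_on UNIV}"
  morphisms ell2_apply Abs_ell2
  by (rule exI[of _ "\<lambda>_. 0"]) simp

setup_lifting type_definition_ell2

lemma sq_summable: "(\<lambda>x. (cmod (ell2_apply f x))\<^sup>2) summable_on UNIV"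
  using ell2_apply by blast

lemma ell2_eqI: "(\<And>x. ell2_apply f x = ell2_apply g x) \<Longrightarrow> f = g"
  by (simp add: ell2_apply_inject[symmetric] ext)

lemma sq_summable_add:
  fixes f g :: "'a \<Rightarrow> complex"
  assumes "(\<lambda>x. (cmod (f x))\<^sup>2) summable_on A" "(\<lambda>x. (cmod (g x))\<^sup>2) summable_on A"
  shows "(\<lambda>x. (cmod (f x + g x))\<^sup>2) summable_on A"
proof (rule summable_on_comparison_test)
  show "(\<lambda>x. 2 * (cmod (f x))\<^sup>2 + 2 * (cmod (g x))\<^sup>2) summable_on A"
    by (intro summable_on_add summable_on_cmult_right assms)
  show "(cmod (f x + g x))\<^sup>2 \<le> 2 * (cmod (f x))\<^sup>2 + 2 * (cmod (g x))\<^sup>2" for x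
  proof -
    have "(cmod (f x + g x))\<^sup>2 \<le> (cmod (f x) + cmod (g x))\<^sup>2"
      by (intro power_mono norm_triangle_ineq) auto
    moreover have "0 \<le> (cmod (f x) - cmod (g x))\<^sup>2" by simp
    ultimately show ?thesis by (simp add: power2_eq_square algebra_simps)
  qed
qed auto

lemma sq_summable_mult:
  fixes f :: "'a \<Rightarrow> complex"
  assumes "(\<lambda>x. (cmod (f x))\<^sup>2) summable_on A"
  shows "(\<lambda>x. (cmod (c * f x))\<^sup>2) summable_on A"
  using summable_on_cmult_right[OF assms, of "(cmod c)\<^sup>2"] by (simp add: norm_mult power_mult_distrib)

lemma cinner_summable:
  "(\<lambda>x. ell2_apply f x * cnj (ell2_apply g x)) summable_on UNIV"
proof (rule abs_summable_summable, rule summable_on_comparison_test)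
  show "(\<lambda>x. (cmod (ell2_apply f x))\<^sup>2 + (cmod (ell2_apply g x))\<^sup>2) summable_on UNIV"
    by (intro summable_on_add sq_summable)
  show "norm (ell2_apply f x * cnj (ell2_apply g x))
      \<le> (cmod (ell2_apply f x))\<^sup>2 + (cmod (ell2_apply g x))\<^sup>2" for x
  proof -
    have "0 \<le> (cmod (ell2_apply f x) - cmod (ell2_apply g x))\<^sup>2" by simp
    moreover have "0 \<le> cmod (ell2_apply f x) * cmod (ell2_apply g x)" by simp
    ultimately show ?thesis unfolding norm_mult complex_mod_cnj power2_diff by linarith
  qed
qed auto

definition cinner :: "'a ell2 \<Rightarrow> 'a ell2 \<Rightarrow> complex" where
  "cinner f g = (\<Sum>\<^sub>\<infinity>x. ell2_apply f x * cnj (ell2_apply g x))"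

text \<open>The distribution has no class of complex inner product spaces. The type is made an instance
  of \<^class>\<open>real_inner\<close> through the real part of \<^const>\<open>cinner\<close>, which induces the usual norm;
  complex scalars act by \<open>scaleC\<close>.\<close>

instantiation ell2 :: (type) real_inner
begin

lift_definition zero_ell2 :: "'a ell2" is "\<lambda>_. 0" by simp
lift_definition plus_ell2 :: "'a ell2 \<Rightarrow> 'a ell2 \<Rightarrow> 'a ell2" is "\<lambda>f g x. f x + g x"
  by (rule sq_summable_add)
lift_definition uminus_ell2 :: "'a ell2 \<Rightarrow> 'a ell2" is "\<lambda>f x. - f x" by simp
lift_definition scaleR_ell2 :: "real \<Rightarrow> 'a ell2 \<Rightarrow> 'a ell2" is "\<lambda>r f x. complex_of_real r * f x"
  by (rule sq_summable_mult)
definition minus_ell2 :: "'a ell2 \<Rightarrow> 'a ell2 \<Rightarrow> 'a ell2" where "f - g = f + - g" for f g :: "'a ell2"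
definition inner_ell2 :: "'a ell2 \<Rightarrow> 'a ell2 \<Rightarrow> real" where "inner_ell2 f g = Re (cinner f g)"
definition norm_ell2 :: "'a ell2 \<Rightarrow> real" where "norm_ell2 f = sqrt (inner f f)"
definition sgn_ell2 :: "'a ell2 \<Rightarrow> 'a ell2" where "sgn_ell2 f = scaleR (inverse (norm f)) f"
definition dist_ell2 :: "'a ell2 \<Rightarrow> 'a ell2 \<Rightarrow> real" where "dist_ell2 f g = norm (f - g)"
definition uniformity_ell2 :: "('a ell2 \<times> 'a ell2) filter" where
  "uniformity_ell2 = (INF e\<in>{0<..}. principal {(x, y). dist x y < e})"
definition open_ell2 :: "'a ell2 set \<Rightarrow> bool" where
  "open_ell2 U = (\<forall>x\<in>U. \<forall>\<^sub>F (x', y) in uniformity. x' = x \<longrightarrow> y \<in> U)"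

lemma cinner_cnj: "cnj (cinner f g) = cinner g f"
  by (simp add: cinner_def flip: infsum_cnj) (simp add: mult.commute)

lemma cinner_add_left: "cinner (f + g) h = cinner f h + cinner g h"
  unfolding cinner_def plus_ell2.rep_eq distrib_right
  by (rule infsum_add) (rule cinner_summable)+

lemma cinner_self: "cinner f f = complex_of_real (\<Sum>\<^sub>\<infinity>x. (cmod (ell2_apply f x))\<^sup>2)"
proof -
  have "cinner f f = (\<Sum>\<^sub>\<infinity>x. complex_of_real ((cmod (ell2_apply f x))\<^sup>2))"
    unfolding cinner_def by (rule infsum_cong) (simp only: complex_norm_square)
  also have "\<dots> = complex_of_real (\<Sum>\<^sub>\<infinity>x. (cmod (ell2_apply f x))\<^sup>2)"
    by (intro infsumI has_sum_bounded_linear[OF bounded_linear_of_real] has_sum_infsum sq_summable)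
  finally show ?thesis .
qed

lemma inner_self_ell2: "inner f f = (\<Sum>\<^sub>\<infinity>x. (cmod (ell2_apply f x))\<^sup>2)" for f :: "'a ell2"
  by (simp add: inner_ell2_def cinner_self)

instance
proof
  fix f g h :: "'a ell2" and r s :: real
  show "f + g + h = f + (g + h)" "f + g = g + f" "0 + f = f" "- f + f = 0"
    "r *\<^sub>R (f + g) = r *\<^sub>R f + r *\<^sub>R g" "(r + s) *\<^sub>R f = r *\<^sub>R f + s *\<^sub>R f"
    "r *\<^sub>R s *\<^sub>R f = (r * s) *\<^sub>R f" "1 *\<^sub>R f = f"
    by (transfer; simp add: algebra_simps)+
  show "f - g = f + - g" by (rule minus_ell2_def)
  show "sgn f = scaleR (inverse (norm f)) f" by (rule sgn_ell2_def)
  show "dist f g = norm (f - g)" by (rule dist_ell2_def)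
  show "uniformity = (INF e\<in>{0<..}. principal {(x :: 'a ell2, y). dist x y < e})"
    by (rule uniformity_ell2_def)
  show "open U = (\<forall>x\<in>U. \<forall>\<^sub>F (x', y) in uniformity. x' = x \<longrightarrow> y \<in> U)" for U :: "'a ell2 set"
    by (rule open_ell2_def)
  show "inner f g = inner g f"
    by (metis inner_ell2_def cinner_cnj complex_cnj(1) cnj.sel(1))
  show "inner (f + g) h = inner f h + inner g h"
    by (simp add: inner_ell2_def cinner_add_left)
  show "inner (r *\<^sub>R f) g = r * inner f g"
    by (simp add: inner_ell2_def cinner_def scaleR_ell2.rep_eq mult.assoc infsum_cmult_right')
  show "0 \<le> inner f f" unfolding inner_self_ell2 by (rule infsum_nonneg) simp
  show "inner f f = 0 \<longleftrightarrow> f = 0"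
  proof
    assume "inner f f = 0"
    then have "(cmod (ell2_apply f x))\<^sup>2 = 0" for x
      using nonneg_infsum_le_0D[OF _ sq_summable[of f], of x] by (simp add: inner_self_ell2)
    then show "f = 0" by (intro ell2_eqI) (simp add: zero_ell2.rep_eq)
  qed (simp add: inner_self_ell2 zero_ell2.rep_eq)
  show "norm f = sqrt (inner f f)" by (rule norm_ell2_def)
qed

end

lift_definition scaleC :: "complex \<Rightarrow> 'a ell2 \<Rightarrow> 'a ell2" is "\<lambda>c f x. c * f x"
  by (rule sq_summable_mult)

lift_definition delta :: "'a \<Rightarrow> 'a ell2" is "\<lambda>x y. if y = x then 1 else 0"
proof -
  fix x :: 'a
  have "(\<lambda>y. (cmod (if y = x then 1 else 0))\<^sup>2) summable_on {x}" by simp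
  then show "(\<lambda>y. (cmod (if y = x then 1 else 0))\<^sup>2) summable_on UNIV"
    by (subst summable_on_cong_neutral[where T="{x}"]) auto
qed

definition ell2_on :: "'a set \<Rightarrow> 'a ell2 set" where
  "ell2_on X = {f. \<forall>x. x \<notin> X \<longrightarrow> ell2_apply f x = 0}"


section \<open>Operators\<close>

text \<open>\<open>bounded_ops X\<close> is \<open>B(\<ell>\<^sub>2(X))\<close>: an operator on \<open>\<ell>\<^sub>2(X)\<close> is identified with its extension by \<open>0\<close>
  on the orthogonal complement \<open>ell2_on (- X)\<close>. This preserves norms, products, adjoints, compactness and
  matrix entries. The type \<open>\<Rightarrow>\<^sub>L\<close> supplies boundedness and real linearity. The unit of
  \<open>bounded_ops X\<close> is the projection onto \<open>ell2_on X\<close>, not \<^const>\<open>id_blinfun\<close>.\<close>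

definition complex_linear :: "('a ell2 \<Rightarrow>\<^sub>L 'a ell2) \<Rightarrow> bool" where
  "complex_linear a \<longleftrightarrow> (\<forall>c f. blinfun_apply a (scaleC c f) = scaleC c (blinfun_apply a f))"

definition bounded_ops :: "'a set \<Rightarrow> ('a ell2 \<Rightarrow>\<^sub>L 'a ell2) set" where
  "bounded_ops X = {a. complex_linear a \<and> (\<forall>f. blinfun_apply a f \<in> ell2_on X) \<and>
     (\<forall>f\<in>ell2_on (- X). blinfun_apply a f = 0)}"

lemma scaleC_apply [simp]: "ell2_apply (scaleC c f) x = c * ell2_apply f x"
  by (simp add: scaleC.rep_eq)

lemma cinner_scaleC_left: "cinner (scaleC c f) g = c * cinner f g"
  by (simp add: cinner_def mult.assoc infsum_cmult_right')

lemma norm_sq_ell2: "(norm f)\<^sup>2 = (\<Sum>\<^sub>\<infinity>x. (cmod (ell2_apply f x))\<^sup>2)" for f :: "'a ell2"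
  by (metis power2_norm_eq_inner inner_self_ell2)

lemma norm_scaleC: "norm (scaleC c f) = cmod c * norm f"
proof -
  have "(norm (scaleC c f))\<^sup>2 = (cmod c * norm f)\<^sup>2"
    by (simp add: norm_sq_ell2 power_mult_distrib norm_mult infsum_cmult_right')
  then show ?thesis by (simp add: power2_eq_iff_nonneg)
qed

lemma cinner_Cauchy_Schwarz: "cmod (cinner f g) \<le> norm f * norm g"
proof (cases "cinner f g = 0")
  case False
  define c where "c = cnj (cinner f g) / cmod (cinner f g)"
  have c: "cmod c = 1" "c * cinner f g = cmod (cinner f g)"
    using False complex_norm_square[of "cinner f g"]
    by (simp_all add: c_def norm_divide power2_eq_square mult.commute divide_eq_eq)
  have "cmod (cinner f g) = inner (scaleC c f) g"
    by (simp add: inner_ell2_def cinner_scaleC_left c)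
  also have "\<dots> \<le> norm (scaleC c f) * norm g" by (rule norm_cauchy_schwarz)
  finally show ?thesis by (simp add: norm_scaleC c)
qed simp

lemma bounded_linear_cinner: "bounded_linear (\<lambda>f. cinner f g)"
proof (rule bounded_linear_intro)
  show "cinner (f + h) g = cinner f g + cinner h g" for f h by (rule cinner_add_left)
  show "cinner (r *\<^sub>R f) g = r *\<^sub>R cinner f g" for r f
    by (simp add: cinner_def scaleR_ell2.rep_eq mult.assoc infsum_cmult_right' scaleR_conv_of_real)
  show "norm (cinner f g) \<le> norm f * norm g" for f by (rule cinner_Cauchy_Schwarz)
qed

lemma ell2_apply_sum: "finite F \<Longrightarrow> ell2_apply (\<Sum>x\<in>F. h x) y = (\<Sum>x\<in>F. ell2_apply (h x) y)"
  by (induction F rule: finite_induct) (simp_all add: zero_ell2.rep_eq plus_ell2.rep_eq)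

lemma finite_expansion:
  assumes "finite F"
  shows "ell2_apply (\<Sum>x\<in>F. scaleC (h x) (delta x)) y = (if y \<in> F then h y else 0)"
proof -
  have "ell2_apply (\<Sum>x\<in>F. scaleC (h x) (delta x)) y = (\<Sum>x\<in>F. if y = x then h x else 0)"
    using assms by (simp add: ell2_apply_sum delta.rep_eq if_distrib cong: if_cong)
  then show ?thesis using assms by simp
qed

lemma expansion: "((\<lambda>x. scaleC (ell2_apply f x) (delta x)) has_sum f) UNIV"
proof -
  let ?s = "\<lambda>F. \<Sum>x\<in>F. scaleC (ell2_apply f x) (delta x)"
  let ?n = "\<lambda>x. (cmod (ell2_apply f x))\<^sup>2"
  have eq: "norm (?s F - f) = sqrt (infsum ?n UNIV - sum ?n F)" if F: "finite F" for F
  proof -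
    have *: "ell2_apply (?s F - f) y = (if y \<in> F then 0 else - ell2_apply f y)" for y
      unfolding minus_ell2_def plus_ell2.rep_eq uminus_ell2.rep_eq finite_expansion[OF F] by simp
    have "(norm (?s F - f))\<^sup>2 = infsum (\<lambda>x. if x \<in> F then 0 else ?n x) UNIV"
      unfolding norm_sq_ell2 * by (rule infsum_cong) simp
    also have "\<dots> = infsum ?n (UNIV - F)" by (rule infsum_cong_neutral) auto
    also have "\<dots> = infsum ?n UNIV - infsum ?n F"
      by (rule infsum_Diff) (use F sq_summable in auto)
    finally have "(norm (?s F - f))\<^sup>2 = infsum ?n UNIV - sum ?n F" using F by simp
    then show ?thesis by (simp add: real_sqrt_unique)
  qed
  have "((\<lambda>F. sum ?n F) \<longlongrightarrow> infsum ?n UNIV) (finite_subsets_at_top UNIV)"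
    using has_sum_infsum[OF sq_summable[of f]] by (simp add: has_sum_def)
  then have "((\<lambda>F. sqrt (infsum ?n UNIV - sum ?n F)) \<longlongrightarrow> sqrt (infsum ?n UNIV - infsum ?n UNIV))
      (finite_subsets_at_top UNIV)"
    by (intro tendsto_real_sqrt tendsto_diff tendsto_const)
  moreover have "\<forall>\<^sub>F F in finite_subsets_at_top UNIV.
      norm (?s F - f) = sqrt (infsum ?n UNIV - sum ?n F)"
    by (rule eventually_finite_subsets_at_top_weakI) (rule eq)
  ultimately have "((\<lambda>F. norm (?s F - f)) \<longlongrightarrow> 0) (finite_subsets_at_top UNIV)"
    by (simp add: tendsto_cong)
  then show ?thesis
    unfolding has_sum_def by (rule LIM_zero_cancel[OF tendsto_norm_zero_cancel])
qed

definition adj :: "('a ell2 \<Rightarrow>\<^sub>L 'a ell2) \<Rightarrow> ('a ell2 \<Rightarrow>\<^sub>L 'a ell2)" where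
  "adj a = (THE b. \<forall>f g. cinner (blinfun_apply a f) g = cinner f (blinfun_apply b g))"

lemma cinner_right_eqI: "(\<And>f. cinner f g = cinner f h) \<Longrightarrow> g = h"
proof -
  assume *: "\<And>f. cinner f g = cinner f h"
  have "inner (g - h) (g - h) = inner (g - h) g - inner (g - h) h" by (rule inner_diff_right)
  also have "\<dots> = 0" by (simp add: inner_ell2_def *)
  finally show "g = h" by simp
qed

lemma adjoint_exists:
  assumes "complex_linear a"
  shows "\<exists>b. \<forall>f g. cinner (blinfun_apply a f) g = cinner f (blinfun_apply b g)"
proof -
  define B where "B g x = cnj (cinner (blinfun_apply a (delta x)) g)" for g x
  have comb: "cinner (blinfun_apply a (\<Sum>x\<in>F. scaleC (h x) (delta x))) g = (\<Sum>x\<in>F. h x * cnj (B g x))"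
    if "finite F" for F h g
    using assms
    by (simp add: blinfun.sum_right linear_sum[OF bounded_linear.linear[OF bounded_linear_cinner]]
        complex_linear_def cinner_scaleC_left B_def)
  have bound: "(\<Sum>x\<in>F. (cmod (B g x))\<^sup>2) \<le> (norm a * norm g)\<^sup>2" if F: "finite F" for F g
  proof -
    define S where "S = (\<Sum>x\<in>F. (cmod (B g x))\<^sup>2)"
    define h where "h = (\<Sum>x\<in>F. scaleC (B g x) (delta x))"
    have S0: "0 \<le> S" unfolding S_def by (rule sum_nonneg) simp
    have "(norm h)\<^sup>2 = infsum (\<lambda>x. (cmod (B g x))\<^sup>2) F"
      unfolding norm_sq_ell2 h_def finite_expansion[OF F] by (rule infsum_cong_neutral) auto
    then have nh: "norm h = sqrt S" using F by (simp add: S_def real_sqrt_unique)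
    have "S = cmod (cinner (blinfun_apply a h) g)"
    proof -
      have "cinner (blinfun_apply a h) g = complex_of_real S"
        unfolding h_def comb[OF F] S_def of_real_sum complex_norm_square ..
      then show ?thesis using S0 by simp
    qed
    also have "\<dots> \<le> norm (blinfun_apply a h) * norm g" by (rule cinner_Cauchy_Schwarz)
    also have "\<dots> \<le> norm a * norm h * norm g" by (intro mult_right_mono norm_blinfun) simp
    finally have "sqrt S * sqrt S \<le> (norm a * norm g) * sqrt S"
      using S0 by (simp add: nh mult_ac)
    then have "sqrt S \<le> norm a * norm g"
      by (metis S0 mult_le_cancel_right norm_ge_zero mult_nonneg_nonneg order_le_less
          real_sqrt_ge_zero linorder_not_less)
    then have "(sqrt S)\<^sup>2 \<le> (norm a * norm g)\<^sup>2" by (intro power_mono) (simp_all add: S0)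
    then show ?thesis using S0 by (simp add: S_def)
  qed
  have summ: "(\<lambda>x. (cmod (B g x))\<^sup>2) summable_on UNIV" for g
    by (rule nonneg_bdd_above_summable_on) (auto intro!: bdd_aboveI2 bound)
  define b where "b g = Abs_ell2 (B g)" for g
  have b: "ell2_apply (b g) x = B g x" for g x
    unfolding b_def using summ by (simp add: Abs_ell2_inverse)
  have adj: "cinner (blinfun_apply a f) g = cinner f (b g)" for f g
  proof -
    have "((\<lambda>x. cinner (blinfun_apply a (scaleC (ell2_apply f x) (delta x))) g)
        has_sum cinner (blinfun_apply a f) g) UNIV"
      by (rule has_sum_bounded_linear[OF bounded_linear_compose[OF bounded_linear_cinner
            blinfun.bounded_linear_right] expansion])
    then have "((\<lambda>x. ell2_apply f x * cnj (B g x)) has_sum cinner (blinfun_apply a f) g) UNIV"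
      using assms by (simp add: complex_linear_def cinner_scaleC_left B_def)
    then show ?thesis by (simp add: cinner_def[of f] b infsumI)
  qed
  have "bounded_linear b"
  proof (rule bounded_linear_intro)
    show "b (g + h) = b g + b h" for g h
      by (rule ell2_eqI) (simp add: b plus_ell2.rep_eq B_def cinner_cnj cinner_add_left)
    show "b (r *\<^sub>R g) = r *\<^sub>R b g" for r g
      by (rule ell2_eqI) (simp add: b scaleR_ell2.rep_eq B_def cinner_cnj
          linear_scale[OF bounded_linear.linear[OF bounded_linear_cinner]] scaleR_conv_of_real)
    show "norm (b g) \<le> norm g * norm a" for g
    proof -
      have "(norm (b g))\<^sup>2 \<le> (norm a * norm g)\<^sup>2"
        unfolding norm_sq_ell2 b by (rule infsum_le_finite_sums[OF summ bound])
      then show ?thesis by (simp add: mult.commute power2_le_iff_abs_le abs_mult)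
    qed
  qed
  then show ?thesis
    using adj by (intro exI[of _ "Blinfun b"]) (simp add: bounded_linear_Blinfun_apply)
qed

lemma cinner_adj:
  assumes "complex_linear a"
  shows "cinner (blinfun_apply a f) g = cinner f (blinfun_apply (adj a) g)"
proof -
  obtain b where b: "\<forall>f g. cinner (blinfun_apply a f) g = cinner f (blinfun_apply b g)"
    using adjoint_exists[OF assms] by blast
  have "adj a = b" unfolding adj_def
  proof (rule the_equality, rule b)
    fix b' assume "\<forall>f g. cinner (blinfun_apply a f) g = cinner f (blinfun_apply b' g)"
    then have "blinfun_apply b' g = blinfun_apply b g" for g
      using b by (metis cinner_right_eqI)
    then show "b' = b" by (rule blinfun_eqI)
  qed
  then show ?thesis using b by simp
qed

definition compact_op :: "('a ell2 \<Rightarrow>\<^sub>L 'a ell2) \<Rightarrow> bool" where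
  "compact_op a \<longleftrightarrow> compact (closure (blinfun_apply a ` cball 0 1))"

definition projection_op :: "('a ell2 \<Rightarrow>\<^sub>L 'a ell2) \<Rightarrow> bool" where
  "projection_op p \<longleftrightarrow> p o\<^sub>L p = p \<and> adj p = p"

definition ghost :: "'a set \<Rightarrow> ('a ell2 \<Rightarrow>\<^sub>L 'a ell2) \<Rightarrow> bool" where
  "ghost X a \<longleftrightarrow> (\<forall>\<epsilon>>0. \<exists>A. finite A \<and> A \<subseteq> X \<and>
     (\<forall>x\<in>X - A. \<forall>y\<in>X - A. cmod (cinner (blinfun_apply a (delta x)) (delta y)) < \<epsilon>))"


section \<open>Uniform Roe algebras and coarse geometry\<close>

definition unif_locally_finite :: "'a set \<Rightarrow> ('a \<Rightarrow> 'a \<Rightarrow> real) \<Rightarrow> bool" where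
  "unif_locally_finite X d \<longleftrightarrow>
     (\<forall>r>0. \<exists>N. \<forall>x\<in>X. finite (Metric_space.mcball X d x r) \<and> card (Metric_space.mcball X d x r) \<le> N)"

definition finite_propagation ::
    "'a set \<Rightarrow> ('a \<Rightarrow> 'a \<Rightarrow> real) \<Rightarrow> ('a ell2 \<Rightarrow>\<^sub>L 'a ell2) \<Rightarrow> bool" where
  "finite_propagation X d a \<longleftrightarrow>
     (\<exists>r>0. \<forall>x\<in>X. \<forall>y\<in>X. d x y > r \<longrightarrow> cinner (blinfun_apply a (delta x)) (delta y) = 0)"

definition uniform_Roe :: "'a set \<Rightarrow> ('a \<Rightarrow> 'a \<Rightarrow> real) \<Rightarrow> ('a ell2 \<Rightarrow>\<^sub>L 'a ell2) set" where
  "uniform_Roe X d = closure {a \<in> bounded_ops X. finite_propagation X d a}"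

definition only_compact_ghost_projections :: "'a set \<Rightarrow> ('a \<Rightarrow> 'a \<Rightarrow> real) \<Rightarrow> bool" where
  "only_compact_ghost_projections X d \<longleftrightarrow>
     (\<forall>p\<in>uniform_Roe X d. projection_op p \<and> ghost X p \<longrightarrow> compact_op p)"

text \<open>The infimum is taken in \<^typ>\<open>ereal\<close>, so the distance to the empty set is \<open>\<infinity>\<close>.\<close>

definition set_distance :: "('a \<Rightarrow> 'a \<Rightarrow> real) \<Rightarrow> 'a set \<Rightarrow> 'a set \<Rightarrow> ereal" where
  "set_distance d A B = (INF x\<in>A. INF y\<in>B. ereal (d x y))"

text \<open>The pieces may be empty, so that finite spaces are sparse.\<close>

definition sparse_space :: "'a set \<Rightarrow> ('a \<Rightarrow> 'a \<Rightarrow> real) \<Rightarrow> bool" where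
  "sparse_space X d \<longleftrightarrow> (\<exists>P :: nat \<Rightarrow> 'a set.
     (\<Union>n. P n) = X \<and> disjoint_family P \<and> (\<forall>n. finite (P n)) \<and>
     (\<forall>R::real. \<exists>N. \<forall>n m. n \<noteq> m \<and> n + m \<ge> N \<longrightarrow> set_distance d (P n) (P m) > ereal R))"

definition coarse_map ::
    "'a set \<Rightarrow> ('a \<Rightarrow> 'a \<Rightarrow> real) \<Rightarrow> 'b set \<Rightarrow> ('b \<Rightarrow> 'b \<Rightarrow> real) \<Rightarrow> ('a \<Rightarrow> 'b) \<Rightarrow> bool" where
  "coarse_map X d Y e f \<longleftrightarrow> f \<in> X \<rightarrow> Y \<and>
     (\<forall>r>0. bdd_above {e (f x) (f y) | x y. x \<in> X \<and> y \<in> X \<and> d x y \<le> r})"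

lemma bounded_linear_scaleC: "bounded_linear (scaleC c)"
proof (rule bounded_linear_intro)
  show "scaleC c (f + g) = scaleC c f + scaleC c g" for f g :: "'a ell2"
    by (rule ell2_eqI) (simp add: plus_ell2.rep_eq algebra_simps)
  show "scaleC c (r *\<^sub>R f) = r *\<^sub>R scaleC c f" for r and f :: "'a ell2"
    by (rule ell2_eqI) (simp add: scaleR_ell2.rep_eq)
  show "norm (scaleC c f) \<le> norm f * cmod c" for f :: "'a ell2"
    by (simp add: norm_scaleC mult.commute)
qed

definition scaleC_op :: "complex \<Rightarrow> ('a ell2 \<Rightarrow>\<^sub>L 'a ell2) \<Rightarrow> ('a ell2 \<Rightarrow>\<^sub>L 'a ell2)" where
  "scaleC_op c a = Blinfun (scaleC c) o\<^sub>L a"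

lemma scaleC_op_apply: "blinfun_apply (scaleC_op c a) f = scaleC c (blinfun_apply a f)"
  by (simp add: scaleC_op_def bounded_linear_Blinfun_apply bounded_linear_scaleC)

definition Roe_embedding ::
    "'a set \<Rightarrow> ('a \<Rightarrow> 'a \<Rightarrow> real) \<Rightarrow> 'b set \<Rightarrow> ('b \<Rightarrow> 'b \<Rightarrow> real) \<Rightarrow>
     (('a ell2 \<Rightarrow>\<^sub>L 'a ell2) \<Rightarrow> ('b ell2 \<Rightarrow>\<^sub>L 'b ell2)) \<Rightarrow> bool" where
  "Roe_embedding X d Y e \<Phi> \<longleftrightarrow>
     \<Phi> \<in> uniform_Roe X d \<rightarrow> uniform_Roe Y e \<and> inj_on \<Phi> (uniform_Roe X d) \<and>
     (\<forall>a\<in>uniform_Roe X d. \<forall>b\<in>uniform_Roe X d. \<Phi> (a + b) = \<Phi> a + \<Phi> b \<and> \<Phi> (a o\<^sub>L b) = \<Phi> a o\<^sub>L \<Phi> b) \<and>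
     (\<forall>a\<in>uniform_Roe X d. (\<forall>c. \<Phi> (scaleC_op c a) = scaleC_op c (\<Phi> a)) \<and> \<Phi> (adj a) = adj (\<Phi> a))"

definition compact_preserving ::
    "'a set \<Rightarrow> ('a \<Rightarrow> 'a \<Rightarrow> real) \<Rightarrow>
     (('a ell2 \<Rightarrow>\<^sub>L 'a ell2) \<Rightarrow> ('b ell2 \<Rightarrow>\<^sub>L 'b ell2)) \<Rightarrow> bool" where
  "compact_preserving X d \<Phi> \<longleftrightarrow> (\<forall>a\<in>uniform_Roe X d. compact_op a \<longrightarrow> compact_op (\<Phi> a))"

end

theory Submission
  imports Defs
begin

text \<open>
  Part (1): an injection \<open>X \<rightarrow> Y\<close> induces an isometry \<open>\<ell>\<^sub>2(X) \<rightarrow> \<ell>\<^sub>2(Y)\<close>, and conjugation with it turns finite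
  propagation over \<open>X\<close> into finite propagation over \<open>Y\<close> because the injection is coarse.

  For (2), write \<open>E A = \<Phi> (diag A)\<close> for the image of the projection onto \<open>\<ell>\<^sub>2(A)\<close>. This is a finitely
  additive projection-valued measure on \<open>X\<close>; compact preservation makes \<open>E {x}\<close> compact. Nothing forces
  \<open>\<Phi>\<close> to be strongly continuous, so \<open>E\<close> need not be countably additive. Along a suitable infinite
  subset of any sequence it is, though: among the members of an uncountable almost disjoint family of
  subsets, only countably many can have a defect visible at a given basis vector \<open>\<delta>\<^sub>y\<close>, and \<open>Y\<close> is countable
  (\<open>ex_infinite_tail_null\<close>, \<open>ex_countably_subadditive_subsequence\<close>).

  The hypothesis on \<open>Y\<close> gives \<open>uniform_lower_bound\<close>: for some constant \<open>c > 0\<close>, each \<open>x\<close> has a point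
  \<open>f x\<close> with \<open>\<parallel>E {x} \<delta>\<^bsub>f x\<^esub>\<parallel> \<ge> c\<close>. Otherwise there are points \<open>x\<^sub>n\<close> for which these norms tend to \<open>0\<close>
  uniformly. Being compact, \<open>E {x\<^sub>n}\<close> almost lives on a finite set \<open>F\<^sub>n\<close>, which can be taken far away
  from the earlier ones. For a suitable infinite set of indices the sum \<open>Q\<close> of the \<open>E {x\<^sub>n}\<close> lies in the
  uniform Roe algebra of \<open>Y\<close>; it is a ghost projection of infinite rank, almost supported on the sparse
  space \<open>Z = \<Union>F\<^sub>n\<close>. The projection onto the range of \<open>diag Z Q\<close> then lies in the uniform Roe algebra of
  \<open>Z\<close> (\<open>ex_corner_inverse\<close>), is a ghost and is not compact: a contradiction.

  The map \<open>f\<close> has bounded fibres, because \<open>\<Sum>\<^sub>x \<parallel>E {x} \<delta>\<^sub>y\<parallel>\<^sup>2 \<le> 1\<close> for each \<open>y\<close>. To see that it is coarse on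
  pieces, move all the vectors \<open>E {x} \<delta>\<^bsub>f x\<^esub>\<close> by matrix units into the range of one projection \<open>E {x0}\<close>,
  obtaining vectors \<open>v x\<close> in a relatively compact set. The inner product of \<open>v x\<close> and \<open>v x'\<close> is the matrix
  entry at \<open>(f x, f x')\<close> of the image under \<open>\<Phi>\<close> of the matrix unit that maps \<open>\<delta>\<^sub>x\<close> to \<open>\<delta>\<^bsub>x'\<^esub>\<close>. Hence
  \<open>X\<close> splits into finitely many pieces on which all these entries are at least \<open>c\<^sup>2/2\<close> in absolute value,
  however large the rank of \<open>E {x0}\<close> is. If \<open>f\<close> failed to be coarse on a piece, some partial translation
  of finite propagation would have an image with entries bounded away from \<open>0\<close> arbitrarily far from the
  diagonal (\<open>coarse_if_large_entries\<close>), which no element of the uniform Roe algebra of \<open>Y\<close> has.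
\<close>

section \<open>Coordinates in \<open>\<ell>\<^sub>2\<close> and completeness\<close>

lemma ell2_apply_add [simp]: "ell2_apply (f + g) x = ell2_apply f x + ell2_apply g x"
  by (simp add: plus_ell2.rep_eq)

lemma ell2_apply_zero [simp]: "ell2_apply 0 x = 0"
  by (simp add: zero_ell2.rep_eq)

lemma ell2_apply_diff [simp]: "ell2_apply (f - g) x = ell2_apply f x - ell2_apply g x"
  unfolding minus_ell2_def ell2_apply_add uminus_ell2.rep_eq by simp

lemma ell2_apply_scaleR [simp]: "ell2_apply (r *\<^sub>R f) x = complex_of_real r * ell2_apply f x"
  by (simp add: scaleR_ell2.rep_eq)

lemma ell2_apply_delta: "ell2_apply (delta x) y = (if y = x then 1 else 0)"
  by (simp add: delta.rep_eq)

lemma cinner_delta [simp]: "cinner f (delta y) = ell2_apply f y"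
proof -
  have "cinner f (delta y) = infsum (\<lambda>x. ell2_apply f x * cnj (ell2_apply (delta y) x)) {y}"
    unfolding cinner_def by (rule infsum_cong_neutral) (auto simp: ell2_apply_delta)
  then show ?thesis by (simp add: ell2_apply_delta)
qed

lemma norm_delta [simp]: "norm (delta x) = 1"
proof -
  have "inner (delta x) (delta x) = 1"
    by (simp add: inner_ell2_def ell2_apply_delta)
  then show ?thesis by (simp add: norm_eq_sqrt_inner)
qed

lemma cmod_ell2_apply_le: "cmod (ell2_apply f y) \<le> norm f"
  using cinner_Cauchy_Schwarz[of f "delta y"] by simp

lemma inner_eq_Re_cinner: "inner f g = Re (cinner f g)"
  by (rule inner_ell2_def)

lemma norm_le_if_square_sums_le:
  assumes "\<And>F. finite F \<Longrightarrow> (\<Sum>x\<in>F. (cmod (ell2_apply v x))\<^sup>2) \<le> C\<^sup>2" and "0 \<le> C"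
  shows "norm v \<le> C"
proof -
  have "(norm v)\<^sup>2 \<le> C\<^sup>2"
    unfolding norm_sq_ell2 by (rule infsum_le_finite_sums[OF sq_summable assms(1)])
  then show ?thesis using assms(2) by (rule power2_le_imp_le)
qed

lemma square_sums_le_norm:
  "finite F \<Longrightarrow> (\<Sum>x\<in>F. (cmod (ell2_apply v x))\<^sup>2) \<le> (norm v)\<^sup>2"
  unfolding norm_sq_ell2 by (rule finite_sum_le_infsum[OF sq_summable]) auto

text \<open>The usual argument: the coordinates converge, and the bound on the finite square sums of
  \<open>F n - F m\<close> survives the limit \<open>m \<rightarrow> \<infinity>\<close>. Completeness is needed to sum a norm convergent series of
  operators in \<open>ex_corner_inverse\<close>.\<close>

lemma Cauchy_ell2_convergent:
  fixes F :: "nat \<Rightarrow> 'a ell2"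
  assumes "Cauchy F"
  shows "convergent F"
proof -
  have coord: "\<exists>l. (\<lambda>n. ell2_apply (F n) x) \<longlonglongrightarrow> l" for x
  proof -
    have "Cauchy (\<lambda>n. ell2_apply (F n) x)"
    proof (rule CauchyI)
      fix r :: real assume "r > 0"
      then obtain M where M: "\<forall>m\<ge>M. \<forall>n\<ge>M. norm (F m - F n) < r"
        using CauchyD[OF \<open>Cauchy F\<close> \<open>r > 0\<close>] by blast
      have "norm (ell2_apply (F m) x - ell2_apply (F n) x) < r" if "m \<ge> M" "n \<ge> M" for m n
        using cmod_ell2_apply_le[of "F m - F n" x] M[rule_format, OF that] by simp
      then show "\<exists>M. \<forall>m\<ge>M. \<forall>n\<ge>M. norm (ell2_apply (F m) x - ell2_apply (F n) x) < r" by blast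
    qed
    then show ?thesis by (rule Cauchy_convergent[unfolded convergent_def])
  qed
  then obtain g where g: "(\<lambda>n. ell2_apply (F n) x) \<longlonglongrightarrow> g x" for x by metis
  have bound: "\<exists>N. \<forall>n\<ge>N. \<forall>S. finite S \<longrightarrow> (\<Sum>x\<in>S. (cmod (ell2_apply (F n) x - g x))\<^sup>2) \<le> r\<^sup>2"
    if "r > 0" for r :: real
  proof -
    obtain M where M: "\<forall>m\<ge>M. \<forall>n\<ge>M. norm (F m - F n) < r"
      using CauchyD[OF \<open>Cauchy F\<close> \<open>r > 0\<close>] by blast
    have "(\<Sum>x\<in>S. (cmod (ell2_apply (F n) x - g x))\<^sup>2) \<le> r\<^sup>2" if "n \<ge> M" "finite S" for n S
    proof (rule LIMSEQ_le_const2)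
      show "(\<lambda>m. \<Sum>x\<in>S. (cmod (ell2_apply (F n) x - ell2_apply (F m) x))\<^sup>2)
          \<longlonglongrightarrow> (\<Sum>x\<in>S. (cmod (ell2_apply (F n) x - g x))\<^sup>2)"
        by (intro tendsto_intros g)
      have "(\<Sum>x\<in>S. (cmod (ell2_apply (F n) x - ell2_apply (F m) x))\<^sup>2) \<le> r\<^sup>2" if "m \<ge> M" for m
      proof -
        have "(\<Sum>x\<in>S. (cmod (ell2_apply (F n - F m) x))\<^sup>2) \<le> (norm (F n - F m))\<^sup>2"
          by (rule square_sums_le_norm[OF \<open>finite S\<close>])
        also have "\<dots> \<le> r\<^sup>2"
          using M[rule_format, OF \<open>n \<ge> M\<close> that] by (simp add: power_mono)
        finally show ?thesis by simp
      qed
      then show "\<exists>N. \<forall>m\<ge>N. (\<Sum>x\<in>S. (cmod (ell2_apply (F n) x - ell2_apply (F m) x))\<^sup>2) \<le> r\<^sup>2"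
        by blast
    qed
    then show ?thesis by blast
  qed
  have summ: "(\<lambda>x. (cmod (g x))\<^sup>2) summable_on UNIV"
  proof -
    obtain N where N: "\<forall>n\<ge>N. \<forall>S. finite S \<longrightarrow>
        (\<Sum>x\<in>S. (cmod (ell2_apply (F n) x - g x))\<^sup>2) \<le> 1\<^sup>2"
      using bound[of 1] by auto
    then have "(\<lambda>x. (cmod (ell2_apply (F N) x - g x))\<^sup>2) summable_on UNIV"
      by (intro nonneg_bdd_above_summable_on) (auto intro!: bdd_aboveI2[where M=1])
    then have "(\<lambda>x. (cmod (- 1 * (ell2_apply (F N) x - g x)))\<^sup>2) summable_on UNIV"
      by (rule sq_summable_mult)
    from sq_summable_add[OF sq_summable[of "F N"] this] show ?thesis by simp
  qed
  define G where "G = Abs_ell2 g"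
  have G: "ell2_apply G x = g x" for x
    using summ by (simp add: G_def Abs_ell2_inverse)
  have "F \<longlonglongrightarrow> G"
  proof (rule LIMSEQ_I)
    fix r :: real assume "r > 0"
    obtain N where N: "\<forall>n\<ge>N. \<forall>S. finite S \<longrightarrow>
        (\<Sum>x\<in>S. (cmod (ell2_apply (F n) x - g x))\<^sup>2) \<le> (r / 2)\<^sup>2"
      using bound[of "r / 2"] \<open>r > 0\<close> by auto
    have "norm (F n - G) \<le> r / 2" if "n \<ge> N" for n
      by (rule norm_le_if_square_sums_le) (use N that \<open>r > 0\<close> in \<open>auto simp: G\<close>)
    then show "\<exists>N. \<forall>n\<ge>N. norm (F n - G) < r"
      using \<open>r > 0\<close> by (intro exI[of _ N]) force
  qed
  then show "convergent F" by (auto simp: convergent_def)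
qed

instance ell2 :: (type) banach
  by standard (rule Cauchy_ell2_convergent)

section \<open>Partial translations\<close>

text \<open>The operator sending \<open>\<delta>\<^sub>x\<close> to \<open>\<delta>\<^bsub>f x\<^esub>\<close> for \<open>x \<in> A\<close> and to \<open>0\<close> otherwise, provided \<open>f\<close> is injective on
  \<open>A\<close>. Diagonal projections, matrix units, partial translations and the isometry induced by an injection
  are all of this form. Through \<^const>\<open>inv_into\<close> the formula defines a contraction for each \<open>f\<close>.\<close>

definition shift :: "'a set \<Rightarrow> ('a \<Rightarrow> 'b) \<Rightarrow> 'a ell2 \<Rightarrow>\<^sub>L 'b ell2" where
  "shift A f = Blinfun (\<lambda>v. Abs_ell2 (\<lambda>y. if y \<in> f ` A then ell2_apply v (inv_into A f y) else 0))"

lemma shift_bounded: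
  fixes f :: "'a \<Rightarrow> 'b"
  shows ell2_apply_shift:
      "ell2_apply (shift A f v) y = (if y \<in> f ` A then ell2_apply v (inv_into A f y) else 0)"
    and norm_shift_le: "norm (shift A f v) \<le> norm v"
proof -
  define T where "T v y = (if y \<in> f ` A then ell2_apply v (inv_into A f y) else 0)" for v y
  have fin: "(\<Sum>y\<in>S. (cmod (T v y))\<^sup>2) \<le> (norm v)\<^sup>2" if "finite S" for S v
  proof -
    have "(\<Sum>y\<in>S. (cmod (T v y))\<^sup>2) = (\<Sum>y\<in>S \<inter> f ` A. (cmod (ell2_apply v (inv_into A f y)))\<^sup>2)"
      using that by (intro sum.mono_neutral_cong_right) (auto simp: T_def)
    also have "\<dots> = (\<Sum>x\<in>inv_into A f ` (S \<inter> f ` A). (cmod (ell2_apply v x))\<^sup>2)"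
      by (rule sum.reindex[symmetric, unfolded o_def]) (simp add: inj_on_inv_into)
    also have "\<dots> \<le> (norm v)\<^sup>2" by (rule square_sums_le_norm) (use that in simp)
    finally show ?thesis .
  qed
  have "(\<lambda>y. (cmod (T v y))\<^sup>2) summable_on UNIV" for v
    by (rule nonneg_bdd_above_summable_on) (auto intro!: bdd_aboveI2 fin)
  then have T: "ell2_apply (Abs_ell2 (T v)) y = T v y" for v y
    by (simp add: Abs_ell2_inverse)
  have n: "norm (Abs_ell2 (T v)) \<le> norm v" for v
    by (rule norm_le_if_square_sums_le) (simp_all add: T fin)
  have "bounded_linear (\<lambda>v. Abs_ell2 (T v))"
  proof (rule bounded_linear_intro)
    show "Abs_ell2 (T (v + w)) = Abs_ell2 (T v) + Abs_ell2 (T w)" for v w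
      by (rule ell2_eqI) (simp add: T, simp add: T_def)
    show "Abs_ell2 (T (r *\<^sub>R v)) = r *\<^sub>R Abs_ell2 (T v)" for r v
      by (rule ell2_eqI) (simp add: T, simp add: T_def)
    show "norm (Abs_ell2 (T v)) \<le> norm v * 1" for v using n by simp
  qed
  then have *: "blinfun_apply (shift A f) v = Abs_ell2 (T v)" for v
    unfolding shift_def T_def by (simp add: bounded_linear_Blinfun_apply)
  show "ell2_apply (shift A f v) y = (if y \<in> f ` A then ell2_apply v (inv_into A f y) else 0)"
    by (simp only: * T) (simp add: T_def)
  show "norm (shift A f v) \<le> norm v" by (simp only: * n)
qed

lemma ell2_apply_shift_image:
  "inj_on f A \<Longrightarrow> x \<in> A \<Longrightarrow> ell2_apply (shift A f v) (f x) = ell2_apply v x"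
  by (simp add: ell2_apply_shift)

lemma ell2_apply_shift_outside:
  "y \<notin> f ` A \<Longrightarrow> ell2_apply (shift A f v) y = 0"
  by (simp add: ell2_apply_shift)

lemma ell2_apply_shift_inv:
  assumes "inj_on f A"
  shows "ell2_apply (shift (f ` A) (inv_into A f) w) x = (if x \<in> A then ell2_apply w (f x) else 0)"
proof (cases "x \<in> A")
  case True
  then have "ell2_apply (shift (f ` A) (inv_into A f) w) (inv_into A f (f x)) = ell2_apply w (f x)"
    by (intro ell2_apply_shift_image) (simp_all add: inj_on_inv_into)
  then show ?thesis using True assms by simp
next
  case False
  then have "x \<notin> inv_into A f ` (f ` A)" using assms by simp
  then show ?thesis using False by (simp add: ell2_apply_shift_outside)
qed

lemma scaleC_shift: "shift A f (scaleC c v) = scaleC c (shift A f v)"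
  by (rule ell2_eqI) (simp add: ell2_apply_shift)

lemma shift_delta:
  assumes "inj_on f A"
  shows "shift A f (delta x) = (if x \<in> A then delta (f x) else 0)"
proof (rule ell2_eqI)
  show "ell2_apply (shift A f (delta x)) y = ell2_apply (if x \<in> A then delta (f x) else 0) y" for y
    using assms by (cases "y \<in> f ` A"; cases "x \<in> A")
      (auto simp: ell2_apply_shift_image ell2_apply_shift_outside ell2_apply_delta inj_on_eq_iff)
qed

lemma shift_inv_delta:
  assumes "inj_on f A"
  shows "x \<in> A \<Longrightarrow> shift (f ` A) (inv_into A f) (delta (f x)) = delta x"
    and "y \<notin> f ` A \<Longrightarrow> shift (f ` A) (inv_into A f) (delta y) = 0"
  using assms by (simp_all add: shift_delta inj_on_inv_into)

text \<open>Both sides are \<open>\<Sum>\<^sub>x\<^sub>\<in>\<^sub>A v x * cnj (w (f x))\<close>.\<close>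

lemma cinner_shift:
  assumes "inj_on f A"
  shows "cinner (shift A f v) w = cinner v (shift (f ` A) (inv_into A f) w)"
proof -
  have "cinner (shift A f v) w = (\<Sum>\<^sub>\<infinity>y\<in>f ` A. ell2_apply (shift A f v) y * cnj (ell2_apply w y))"
    unfolding cinner_def by (rule infsum_cong_neutral) (auto simp: ell2_apply_shift_outside)
  also have "\<dots> = (\<Sum>\<^sub>\<infinity>x\<in>A. ell2_apply (shift A f v) (f x) * cnj (ell2_apply w (f x)))"
    by (subst infsum_reindex[OF assms]) (simp add: o_def)
  also have "\<dots> = (\<Sum>\<^sub>\<infinity>x\<in>A. ell2_apply v x * cnj (ell2_apply w (f x)))"
    by (rule infsum_cong) (simp add: ell2_apply_shift_image[OF assms])
  also have "\<dots> = cinner v (shift (f ` A) (inv_into A f) w)"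
    unfolding cinner_def by (rule infsum_cong_neutral) (auto simp: ell2_apply_shift_inv[OF assms])
  finally show ?thesis .
qed

abbreviation diag :: "'a set \<Rightarrow> 'a ell2 \<Rightarrow>\<^sub>L 'a ell2" where
  "diag A \<equiv> shift A id"

lemma ell2_apply_diag: "ell2_apply (diag A v) x = (if x \<in> A then ell2_apply v x else 0)"
  using ell2_apply_shift_image[of id A x v] ell2_apply_shift_outside[of x id A v] by auto

lemma shift_inv_shift:
  assumes "inj_on f A"
  shows "shift (f ` A) (inv_into A f) (shift A f v) = diag A v"
  by (rule ell2_eqI)
    (simp add: ell2_apply_shift_inv[OF assms] ell2_apply_shift_image[OF assms] ell2_apply_diag)

lemma adj_eqI:
  assumes "\<And>f g. cinner (blinfun_apply a f) g = cinner f (blinfun_apply b g)"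
  shows "adj a = b"
  unfolding adj_def
proof (rule the_equality)
  show "\<forall>f g. cinner (blinfun_apply a f) g = cinner f (blinfun_apply b g)" using assms by blast
  fix b' assume "\<forall>f g. cinner (blinfun_apply a f) g = cinner f (blinfun_apply b' g)"
  then show "b' = b"
    using assms by (intro blinfun_eqI cinner_right_eqI) simp
qed

lemma inner_adj:
  "complex_linear a \<Longrightarrow> inner (blinfun_apply a f) g = inner f (blinfun_apply (adj a) g)"
  by (simp add: inner_eq_Re_cinner cinner_adj)

lemma adj_shift:
  "inj_on g A \<Longrightarrow> adj (shift A g) = shift (g ` A) (inv_into A g)" for g :: "'a \<Rightarrow> 'a"
  by (rule adj_eqI) (rule cinner_shift)

lemma adj_diag: "adj (diag A) = diag A"
proof -
  have "shift (id ` A) (inv_into A id) w = diag A w" for w :: "'a ell2"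
    by (rule ell2_eqI) (use ell2_apply_shift_inv[of id A w] in \<open>simp add: ell2_apply_diag\<close>)
  then have "shift (id ` A) (inv_into A id) = diag A" by (rule blinfun_eqI)
  then show ?thesis using adj_shift[of id A] by simp
qed

lemma complex_linear_shift: "complex_linear (shift A g)"
  by (simp add: complex_linear_def scaleC_shift)

lemma complex_linear_compose:
  "complex_linear a \<Longrightarrow> complex_linear b \<Longrightarrow> complex_linear (a o\<^sub>L b)"
  by (simp add: complex_linear_def)

lemma scaleC_add_right: "scaleC c (f + g) = scaleC c f + scaleC c g"
  by (rule ell2_eqI) (simp add: algebra_simps)

lemma scaleC_diff_right: "scaleC c (f - g) = scaleC c f - scaleC c g"
  by (rule ell2_eqI) (simp add: algebra_simps)

lemma scaleC_zero_right [simp]: "scaleC c 0 = 0"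
  by (rule ell2_eqI) simp

text \<open>A bounded complex linear operator is determined by its values on the canonical basis.\<close>

lemma operator_expansion:
  assumes "complex_linear a"
  shows "((\<lambda>y. scaleC (ell2_apply v y) (blinfun_apply a (delta y))) has_sum blinfun_apply a v) UNIV"
  using has_sum_bounded_linear[OF blinfun.bounded_linear_right[of a] expansion[of v]] assms
  by (simp add: complex_linear_def)

section \<open>The uniform Roe algebra\<close>

lemma closed_bounded_ops: "closed (bounded_ops X)"
proof -
  have "bounded_ops X = (\<Inter>c. \<Inter>f. {a. blinfun_apply a (scaleC c f) = scaleC c (blinfun_apply a f)})
     \<inter> (\<Inter>f. \<Inter>x\<in>- X. {a. cinner (blinfun_apply a f) (delta x) = 0})
     \<inter> (\<Inter>f\<in>ell2_on (- X). {a. blinfun_apply a f = 0})"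
    by (auto simp: bounded_ops_def complex_linear_def ell2_on_def)
  also have "closed \<dots>"
  proof -
    have 1: "continuous_on UNIV (\<lambda>a :: 'a ell2 \<Rightarrow>\<^sub>L 'a ell2. blinfun_apply a f)" for f
      by (rule bounded_linear.continuous_on[OF blinfun.bounded_linear_left continuous_on_id])
    have 2: "continuous_on UNIV (\<lambda>a :: 'a ell2 \<Rightarrow>\<^sub>L 'a ell2. scaleC c (blinfun_apply a f))" for c f
      by (rule bounded_linear.continuous_on[OF bounded_linear_scaleC 1])
    have 3: "continuous_on UNIV (\<lambda>a :: 'a ell2 \<Rightarrow>\<^sub>L 'a ell2. cinner (blinfun_apply a f) g)" for f g
      by (rule bounded_linear.continuous_on[OF bounded_linear_cinner 1])
    show ?thesis
      by (rule closed_Int closed_INT ballI closed_Collect_eq 1 2 3 continuous_on_const)+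
  qed
  finally show ?thesis .
qed

lemma uniform_Roe_bounded_ops: "a \<in> uniform_Roe X d \<Longrightarrow> a \<in> bounded_ops X"
  unfolding uniform_Roe_def
  using closure_minimal[OF _ closed_bounded_ops, of "{a \<in> bounded_ops X. finite_propagation X d a}" X]
  by blast

lemma bounded_ops_complex_linear: "a \<in> bounded_ops X \<Longrightarrow> complex_linear a"
  by (simp add: bounded_ops_def)

lemma uniform_Roe_complex_linear: "a \<in> uniform_Roe X d \<Longrightarrow> complex_linear a"
  by (intro bounded_ops_complex_linear uniform_Roe_bounded_ops)

lemma bounded_ops_outside: "a \<in> bounded_ops X \<Longrightarrow> x \<notin> X \<Longrightarrow> ell2_apply (blinfun_apply a v) x = 0"
  by (simp add: bounded_ops_def ell2_on_def)

lemma bounded_ops_delta_outside: "a \<in> bounded_ops X \<Longrightarrow> x \<notin> X \<Longrightarrow> blinfun_apply a (delta x) = 0"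
  by (auto simp: bounded_ops_def ell2_on_def ell2_apply_delta)

lemma bounded_ops_compose_diag:
  assumes "a \<in> bounded_ops X"
  shows "blinfun_apply a (diag X v) = blinfun_apply a v" "diag X (blinfun_apply a v) = blinfun_apply a v"
proof -
  have "v - diag X v \<in> ell2_on (- X)" by (simp add: ell2_on_def ell2_apply_diag)
  then have "blinfun_apply a (v - diag X v) = 0" using assms by (simp add: bounded_ops_def)
  then show "blinfun_apply a (diag X v) = blinfun_apply a v" by (simp add: blinfun.diff_right)
  show "diag X (blinfun_apply a v) = blinfun_apply a v"
    by (rule ell2_eqI) (simp add: ell2_apply_diag bounded_ops_outside[OF assms])
qed

lemma finite_propagationI:
  assumes "\<And>x y. x \<in> X \<Longrightarrow> y \<in> X \<Longrightarrow> d x y > r \<Longrightarrow> ell2_apply (blinfun_apply a (delta x)) y = 0"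
  shows "finite_propagation X d a"
  unfolding finite_propagation_def by (rule exI[of _ "max r 1"]) (use assms in auto)

lemma finite_propagationE:
  assumes "finite_propagation X d a"
  obtains r where "r > 0" "\<And>x y. x \<in> X \<Longrightarrow> y \<in> X \<Longrightarrow> d x y > r \<Longrightarrow> ell2_apply (blinfun_apply a (delta x)) y = 0"
  using assms unfolding finite_propagation_def cinner_delta by blast

lemma uniform_Roe_approx:
  assumes "a \<in> uniform_Roe X d" "\<epsilon> > 0"
  obtains b where "b \<in> bounded_ops X" "finite_propagation X d b" "norm (a - b) < \<epsilon>"
  using assms unfolding uniform_Roe_def closure_approachable
  by (auto simp: dist_norm norm_minus_commute)

lemma closed_uniform_Roe: "closed (uniform_Roe X d)"
  by (simp add: uniform_Roe_def)

lemma uniform_RoeI: "a \<in> bounded_ops X \<Longrightarrow> finite_propagation X d a \<Longrightarrow> a \<in> uniform_Roe X d"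
  unfolding uniform_Roe_def by (rule subsetD[OF closure_subset]) simp

lemma uniform_RoeE:
  assumes "a \<in> uniform_Roe X d"
  obtains f where "\<And>n. f n \<in> bounded_ops X" "\<And>n. finite_propagation X d (f n)" "f \<longlonglongrightarrow> a"
proof -
  obtain f where "\<forall>n. f n \<in> {a \<in> bounded_ops X. finite_propagation X d a}" "f \<longlonglongrightarrow> a"
    using assms unfolding uniform_Roe_def closure_sequential by blast
  then show ?thesis by (intro that[of f]) auto
qed

text \<open>Closure under a jointly continuous binary operation has to be checked on operators of finite
  propagation only.\<close>

lemma uniform_Roe_binop:
  fixes F :: "('a ell2 \<Rightarrow>\<^sub>L 'a ell2) \<Rightarrow> ('a ell2 \<Rightarrow>\<^sub>L 'a ell2) \<Rightarrow> ('a ell2 \<Rightarrow>\<^sub>L 'a ell2)"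
  assumes F: "\<And>a b. a \<in> bounded_ops X \<Longrightarrow> b \<in> bounded_ops X \<Longrightarrow> finite_propagation X d a \<Longrightarrow>
      finite_propagation X d b \<Longrightarrow> F a b \<in> bounded_ops X \<and> finite_propagation X d (F a b)"
    and cont: "\<And>f g a b. f \<longlonglongrightarrow> a \<Longrightarrow> g \<longlonglongrightarrow> b \<Longrightarrow> (\<lambda>n. F (f n) (g n)) \<longlonglongrightarrow> F a b"
    and "a \<in> uniform_Roe X d" "b \<in> uniform_Roe X d"
  shows "F a b \<in> uniform_Roe X d"
proof -
  obtain f where f: "\<And>n. f n \<in> bounded_ops X" "\<And>n. finite_propagation X d (f n)" "f \<longlonglongrightarrow> a"
    using uniform_RoeE[OF assms(3)] by metis
  obtain g where g: "\<And>n. g n \<in> bounded_ops X" "\<And>n. finite_propagation X d (g n)" "g \<longlonglongrightarrow> b"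
    using uniform_RoeE[OF assms(4)] by metis
  show ?thesis
  proof (rule closed_sequentially[OF closed_uniform_Roe])
    show "F (f n) (g n) \<in> uniform_Roe X d" for n
      using F[OF f(1) g(1) f(2) g(2)] by (intro uniform_RoeI) auto
    show "(\<lambda>n. F (f n) (g n)) \<longlonglongrightarrow> F a b" by (rule cont[OF f(3) g(3)])
  qed
qed

lemma uniform_Roe_add:
  assumes "a \<in> uniform_Roe X d" "b \<in> uniform_Roe X d"
  shows "a + b \<in> uniform_Roe X d"
proof (rule uniform_Roe_binop[OF _ tendsto_add assms])
  fix a b :: "'a ell2 \<Rightarrow>\<^sub>L 'a ell2"
  assume ab: "a \<in> bounded_ops X" "b \<in> bounded_ops X" "finite_propagation X d a" "finite_propagation X d b"
  obtain r where r: "\<And>x y. x \<in> X \<Longrightarrow> y \<in> X \<Longrightarrow> d x y > r \<Longrightarrow> ell2_apply (blinfun_apply a (delta x)) y = 0"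
    using ab(3) by (rule finite_propagationE) blast
  obtain s where s: "\<And>x y. x \<in> X \<Longrightarrow> y \<in> X \<Longrightarrow> d x y > s \<Longrightarrow> ell2_apply (blinfun_apply b (delta x)) y = 0"
    using ab(4) by (rule finite_propagationE) blast
  have "finite_propagation X d (a + b)"
    by (rule finite_propagationI[where r="max r s"]) (simp add: blinfun.add_left r s)
  then show "a + b \<in> bounded_ops X \<and> finite_propagation X d (a + b)"
    using ab(1,2) by (simp add: bounded_ops_def complex_linear_def blinfun.add_left scaleC_add_right ell2_on_def)
qed

text \<open>Propagations add up: if \<open>d x z > r + s\<close>, the triangle inequality makes each summand of
  \<open>\<Sum>\<^sub>y \<langle>b \<delta>\<^sub>x, \<delta>\<^sub>y\<rangle> \<langle>a \<delta>\<^sub>y, \<delta>\<^sub>z\<rangle>\<close> vanish.\<close>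

lemma uniform_Roe_compose:
  assumes X: "Metric_space X d" and "a \<in> uniform_Roe X d" "b \<in> uniform_Roe X d"
  shows "a o\<^sub>L b \<in> uniform_Roe X d"
proof (rule uniform_Roe_binop[OF _ _ assms(2,3)])
  interpret Metric_space X d by (rule X)
  fix a b :: "'a ell2 \<Rightarrow>\<^sub>L 'a ell2"
  assume ab: "a \<in> bounded_ops X" "b \<in> bounded_ops X" "finite_propagation X d a" "finite_propagation X d b"
  obtain r where r: "\<And>x y. x \<in> X \<Longrightarrow> y \<in> X \<Longrightarrow> d x y > r \<Longrightarrow> ell2_apply (blinfun_apply a (delta x)) y = 0"
    using ab(3) by (rule finite_propagationE) blast
  obtain s where s: "\<And>x y. x \<in> X \<Longrightarrow> y \<in> X \<Longrightarrow> d x y > s \<Longrightarrow> ell2_apply (blinfun_apply b (delta x)) y = 0"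
    using ab(4) by (rule finite_propagationE) blast
  have "finite_propagation X d (a o\<^sub>L b)"
  proof (rule finite_propagationI[where r="r + s"])
    fix x z assume xz: "x \<in> X" "z \<in> X" "r + s < d x z"
    have "((\<lambda>y. cinner (scaleC (ell2_apply (b (delta x)) y) (blinfun_apply a (delta y))) (delta z))
        has_sum cinner (a (b (delta x))) (delta z)) UNIV"
      by (rule has_sum_bounded_linear[OF bounded_linear_cinner
            operator_expansion[OF bounded_ops_complex_linear[OF ab(1)]]])
    moreover have "cinner (scaleC (ell2_apply (b (delta x)) y) (blinfun_apply a (delta y))) (delta z) = 0" for y
    proof (cases "y \<in> X")
      case True
      then have "d x y > s \<or> d y z > r" using triangle[of x y z] xz by linarith
      then show ?thesis using r[of y z] s[of x y] True xz by auto
    qed (simp add: bounded_ops_outside[OF ab(2)])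
    ultimately have "((\<lambda>y :: 'a. 0) has_sum ell2_apply (a (b (delta x))) z) UNIV"
      by (simp only: cinner_delta)
    then show "ell2_apply (blinfun_apply (a o\<^sub>L b) (delta x)) z = 0"
      using has_sum_unique[OF _ has_sum_0_simp] by simp
  qed
  then show "a o\<^sub>L b \<in> bounded_ops X \<and> finite_propagation X d (a o\<^sub>L b)"
    using ab(1,2) by (simp add: bounded_ops_def complex_linear_def)
qed (rule bounded_bilinear.tendsto[OF bounded_bilinear_blinfun_compose])

lemma uniform_Roe_diff:
  assumes "a \<in> uniform_Roe X d" "b \<in> uniform_Roe X d"
  shows "a - b \<in> uniform_Roe X d"
proof (rule uniform_Roe_binop[OF _ tendsto_diff assms])
  fix a b :: "'a ell2 \<Rightarrow>\<^sub>L 'a ell2"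
  assume ab: "a \<in> bounded_ops X" "b \<in> bounded_ops X" "finite_propagation X d a" "finite_propagation X d b"
  obtain r where r: "\<And>x y. x \<in> X \<Longrightarrow> y \<in> X \<Longrightarrow> d x y > r \<Longrightarrow> ell2_apply (blinfun_apply a (delta x)) y = 0"
    using ab(3) by (rule finite_propagationE) blast
  obtain s where s: "\<And>x y. x \<in> X \<Longrightarrow> y \<in> X \<Longrightarrow> d x y > s \<Longrightarrow> ell2_apply (blinfun_apply b (delta x)) y = 0"
    using ab(4) by (rule finite_propagationE) blast
  have "finite_propagation X d (a - b)"
    by (rule finite_propagationI[where r="max r s"]) (simp add: blinfun.diff_left r s)
  then show "a - b \<in> bounded_ops X \<and> finite_propagation X d (a - b)"
    using ab(1,2) by (simp add: bounded_ops_def complex_linear_def blinfun.diff_left scaleC_diff_right ell2_on_def)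
qed

lemma shift_in_uniform_Roe:
  assumes "A \<subseteq> X" "g ` A \<subseteq> X" "inj_on g A" "\<And>x. x \<in> A \<Longrightarrow> d x (g x) \<le> r"
  shows "shift A g \<in> uniform_Roe X d"
proof (rule uniform_RoeI)
  have "shift A g f = 0" if "f \<in> ell2_on (- X)" for f
  proof (rule ell2_eqI)
    show "ell2_apply (shift A g f) y = ell2_apply 0 y" for y
      using that assms(1,3) by (cases "y \<in> g ` A")
        (auto simp: ell2_apply_shift_image ell2_apply_shift_outside ell2_on_def)
  qed
  moreover have "shift A g f \<in> ell2_on X" for f
    using assms(2) by (auto simp: ell2_on_def intro!: ell2_apply_shift_outside)
  ultimately show "shift A g \<in> bounded_ops X" by (simp add: bounded_ops_def complex_linear_shift)
  show "finite_propagation X d (shift A g)"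
  proof (rule finite_propagationI[where r=r])
    fix x y assume "r < d x y"
    then show "ell2_apply (shift A g (delta x)) y = 0"
      using assms(4)[of x] by (auto simp: shift_delta[OF assms(3)] ell2_apply_delta)
  qed
qed

lemma diag_in_uniform_Roe:
  assumes "Metric_space X d" "A \<subseteq> X"
  shows "diag A \<in> uniform_Roe X d"
proof -
  interpret Metric_space X d by (rule assms(1))
  show ?thesis by (rule shift_in_uniform_Roe[of _ _ _ _ 0]) (use assms(2) in auto)
qed

lemma compression_in_uniform_Roe:
  assumes "Z \<subseteq> Y" "a \<in> uniform_Roe Y e"
  shows "diag Z o\<^sub>L a o\<^sub>L diag Z \<in> uniform_Roe Z e"
proof -
  obtain f where f: "\<And>n. f n \<in> bounded_ops Y" "\<And>n. finite_propagation Y e (f n)" "f \<longlonglongrightarrow> a"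
    using uniform_RoeE[OF assms(2)] by metis
  have "diag Z o\<^sub>L f n o\<^sub>L diag Z \<in> uniform_Roe Z e" for n
  proof (rule uniform_RoeI)
    have "diag Z v = 0" if "v \<in> ell2_on (- Z)" for v
      by (rule ell2_eqI) (use that in \<open>simp add: ell2_on_def ell2_apply_diag\<close>)
    then show "diag Z o\<^sub>L f n o\<^sub>L diag Z \<in> bounded_ops Z"
      using complex_linear_compose[OF complex_linear_compose, OF complex_linear_shift _ complex_linear_shift]
        bounded_ops_complex_linear[OF f(1)[of n]] by (auto simp: bounded_ops_def ell2_on_def ell2_apply_diag blinfun.zero_right)
    obtain r where r: "\<And>x y. x \<in> Y \<Longrightarrow> y \<in> Y \<Longrightarrow> e x y > r \<Longrightarrow> ell2_apply (f n (delta x)) y = 0"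
      using f(2)[of n] by (rule finite_propagationE) blast
    show "finite_propagation Z e (diag Z o\<^sub>L f n o\<^sub>L diag Z)"
      by (rule finite_propagationI[where r=r])
        (use r assms(1) in \<open>auto simp: shift_delta ell2_apply_diag\<close>)
  qed
  moreover have "(\<lambda>n. diag Z o\<^sub>L f n o\<^sub>L diag Z) \<longlonglongrightarrow> (diag Z o\<^sub>L a o\<^sub>L diag Z)"
    by (intro bounded_bilinear.tendsto[OF bounded_bilinear_blinfun_compose] tendsto_const f(3))
  ultimately show ?thesis by (rule closed_sequentially[OF closed_uniform_Roe])
qed

section \<open>Injective coarse maps induce embeddings\<close>

text \<open>Conjugation \<open>a \<mapsto> u a u\<^sup>*\<close> with the isometry \<open>u \<delta>\<^sub>x = \<delta>\<^bsub>f x\<^esub>\<close>. It is multiplicative and injective because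
  \<open>u\<^sup>* u\<close> is the unit of \<open>B(\<ell>\<^sub>2(X))\<close>.\<close>

lemma Roe_embedding_of_coarse_injection:
  fixes f :: "'a \<Rightarrow> 'b"
  assumes f: "coarse_map X d Y e f" and inj: "inj_on f X"
  shows "\<exists>\<Phi>. Roe_embedding X d Y e \<Phi>"
proof -
  define u where "u = shift X f"
  define u' where "u' = shift (f ` X) (inv_into X f)"
  define \<Phi> where "\<Phi> a = u o\<^sub>L a o\<^sub>L u'" for a :: "'a ell2 \<Rightarrow>\<^sub>L 'a ell2"
  have u'u: "u' (u v) = diag X v" for v
    unfolding u_def u'_def by (rule shift_inv_shift[OF inj])
  have uu': "cinner (u v) w = cinner v (u' w)" for v w
    unfolding u_def u'_def by (rule cinner_shift[OF inj])
  have u'u2: "cinner (u' w) v = cinner w (u v)" for v w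
    by (metis uu' cinner_cnj)
  have fp: "\<Phi> a \<in> uniform_Roe Y e" if a: "a \<in> bounded_ops X" "finite_propagation X d a" for a
  proof (rule uniform_RoeI)
    have "u' v = 0" if "v \<in> ell2_on (- Y)" for v
    proof (rule ell2_eqI)
      show "ell2_apply (u' v) x = ell2_apply 0 x" for x
        using that f by (auto simp: u'_def ell2_apply_shift_inv[OF inj] ell2_on_def coarse_map_def)
    qed
    moreover have "u v \<in> ell2_on Y" for v
      using f by (auto simp: u_def ell2_on_def coarse_map_def intro!: ell2_apply_shift_outside)
    ultimately show "\<Phi> a \<in> bounded_ops Y"
      using bounded_ops_complex_linear[OF a(1)]
      by (simp add: \<Phi>_def bounded_ops_def complex_linear_def u_def u'_def scaleC_shift blinfun.zero_right)
    obtain r where "r > 0" and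
      r: "\<And>x y. x \<in> X \<Longrightarrow> y \<in> X \<Longrightarrow> d x y > r \<Longrightarrow> ell2_apply (blinfun_apply a (delta x)) y = 0"
      using a(2) by (rule finite_propagationE) blast
    obtain M where M: "\<And>x y. x \<in> X \<Longrightarrow> y \<in> X \<Longrightarrow> d x y \<le> r \<Longrightarrow> e (f x) (f y) \<le> M"
      using f \<open>r > 0\<close> unfolding coarse_map_def bdd_above_def by blast
    show "finite_propagation Y e (\<Phi> a)"
    proof (rule finite_propagationI[where r=M])
      fix y z assume "M < e y z"
      show "ell2_apply (\<Phi> a (delta y)) z = 0"
      proof (cases "y \<in> f ` X \<and> z \<in> f ` X")
        case True
        then obtain x x' where x: "x \<in> X" "x' \<in> X" "y = f x" "z = f x'" by blast
        then have "d x x' > r" using M[of x x'] \<open>M < e y z\<close> by force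
        then show ?thesis
          using x r by (simp add: \<Phi>_def u_def u'_def shift_inv_delta[OF inj] ell2_apply_shift_image[OF inj])
      next
        case False
        then show ?thesis
          by (auto simp: \<Phi>_def u_def u'_def shift_inv_delta[OF inj] ell2_apply_shift_outside blinfun.zero_right)
      qed
    qed
  qed
  have cont: "continuous_on S \<Phi>" for S
    unfolding \<Phi>_def by (intro continuous_intros bounded_bilinear.continuous_on[OF bounded_bilinear_blinfun_compose])
  have maps: "\<Phi> a \<in> uniform_Roe Y e" if "a \<in> uniform_Roe X d" for a
  proof -
    have "\<Phi> ` closure {a \<in> bounded_ops X. finite_propagation X d a} \<subseteq> uniform_Roe Y e"
      by (rule image_closure_subset[OF cont closed_uniform_Roe]) (use fp in auto)
    then show ?thesis using that unfolding uniform_Roe_def[of X d] by blast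
  qed
  have recover: "u' (\<Phi> a (u v)) = a v" if "a \<in> uniform_Roe X d" for a v
    using bounded_ops_compose_diag[OF uniform_Roe_bounded_ops[OF that]] by (simp add: \<Phi>_def u'u)
  have "inj_on \<Phi> (uniform_Roe X d)"
    by (rule inj_onI) (metis recover blinfun_eqI)
  moreover have "\<Phi> (a + b) = \<Phi> a + \<Phi> b" for a b
    by (rule blinfun_eqI) (simp add: \<Phi>_def blinfun.add_left blinfun.add_right)
  moreover have "\<Phi> (a o\<^sub>L b) = \<Phi> a o\<^sub>L \<Phi> b" if "a \<in> uniform_Roe X d" for a b
    by (rule blinfun_eqI)
      (simp add: \<Phi>_def u'u bounded_ops_compose_diag[OF uniform_Roe_bounded_ops[OF that]])
  moreover have "\<Phi> (scaleC_op c a) = scaleC_op c (\<Phi> a)" for c a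
    by (rule blinfun_eqI) (simp add: \<Phi>_def scaleC_op_apply u_def scaleC_shift)
  moreover have "\<Phi> (adj a) = adj (\<Phi> a)" if "a \<in> uniform_Roe X d" for a
    by (rule adj_eqI[symmetric])
      (simp add: \<Phi>_def uu' u'u2 cinner_adj uniform_Roe_complex_linear[OF that])
  ultimately show ?thesis using maps unfolding Roe_embedding_def by blast
qed

section \<open>Finitely additive measures along subsequences\<close>

text \<open>Countably many finitely additive bounded measures on \<open>\<nat>\<close> become countably additive at the same time on
  a suitable infinite set. For real \<open>r\<close> let \<open>S r\<close> code the sequence \<open>(n, \<lfloor>n r\<rfloor>)\<close>; different reals give
  almost disjoint infinite sets. After removal of a common finite set, finitely many of them are disjoint,
  so for each \<open>y\<close> and each \<open>k\<close> only finitely many \<open>S r\<close> have all their tails of \<open>\<mu> y\<close>-measure at least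
  \<open>1 / (k + 1)\<close>. Uncountably many \<open>r\<close> remain.\<close>

lemma ex_infinite_tail_null:
  fixes \<mu> :: "'y \<Rightarrow> nat set \<Rightarrow> real"
  assumes Y: "countable Y" and nonneg: "\<And>y A. y \<in> Y \<Longrightarrow> 0 \<le> \<mu> y A"
    and add: "\<And>y A B. y \<in> Y \<Longrightarrow> A \<inter> B = {} \<Longrightarrow> \<mu> y (A \<union> B) = \<mu> y A + \<mu> y B"
  obtains A where "infinite A" "\<And>y \<epsilon>. y \<in> Y \<Longrightarrow> \<epsilon> > 0 \<Longrightarrow> \<exists>N. \<mu> y (A \<inter> {N..}) < \<epsilon>"
proof -
  define S where "S r = range (\<lambda>n. to_nat (n, \<lfloor>real n * r\<rfloor>))" for r :: real
  have inf: "infinite (S r)" for r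
    unfolding S_def by (rule range_inj_infinite) (auto intro!: injI)
  have fin: "finite (S r \<inter> S t)" if "r \<noteq> t" for r t
  proof -
    have bound: "n \<le> nat \<lceil>1 / \<bar>r - t\<bar>\<rceil>" if "\<lfloor>real n * r\<rfloor> = \<lfloor>real n * t\<rfloor>" for n
    proof -
      have "\<bar>real n * r - real n * t\<bar> < 1" using that by linarith
      then have "real n * \<bar>r - t\<bar> < 1" by (simp add: abs_mult flip: right_diff_distrib)
      then have "real n < 1 / \<bar>r - t\<bar>" using \<open>r \<noteq> t\<close> by (simp add: field_simps)
      then show ?thesis by linarith
    qed
    have "S r \<inter> S t \<subseteq> (\<lambda>n. to_nat (n, \<lfloor>real n * r\<rfloor>)) ` {..nat \<lceil>1 / \<bar>r - t\<bar>\<rceil>}"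
    proof
      fix m assume "m \<in> S r \<inter> S t"
      then obtain n n' where n: "m = to_nat (n, \<lfloor>real n * r\<rfloor>)" "m = to_nat (n', \<lfloor>real n' * t\<rfloor>)"
        unfolding S_def by blast
      then have "(n, \<lfloor>real n * r\<rfloor>) = (n', \<lfloor>real n' * t\<rfloor>)" by (metis from_nat_to_nat)
      then show "m \<in> (\<lambda>n. to_nat (n, \<lfloor>real n * r\<rfloor>)) ` {..nat \<lceil>1 / \<bar>r - t\<bar>\<rceil>}"
        using n(1) bound[of n] by auto
    qed
    then show ?thesis by (rule finite_subset) simp
  qed
  define bad where "bad y k = {r. \<forall>N. 1 / real (Suc k) \<le> \<mu> y (S r \<inter> {N..})}" for y k
  have "finite (bad y k)" if y: "y \<in> Y" for y k
  proof -
    have le_UNIV: "\<mu> y B \<le> \<mu> y UNIV" for B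
      using add[OF y, of B "- B"] nonneg[OF y, of "- B"] by simp
    have "card T \<le> nat \<lfloor>real (Suc k) * \<mu> y UNIV\<rfloor>" if T: "T \<subseteq> bad y k" "finite T" for T
    proof -
      have "finite (\<Union>r\<in>T. \<Union>t\<in>T - {r}. S r \<inter> S t)"
        using T(2) by (intro finite_UN_I) (auto intro: fin)
      then obtain N where N: "(\<Union>r\<in>T. \<Union>t\<in>T - {r}. S r \<inter> S t) \<subseteq> {..<N}"
        by (auto simp: finite_nat_iff_bounded)
      have disj: "(S r \<inter> {N..}) \<inter> (S t \<inter> {N..}) = {}" if "r \<in> T" "t \<in> T" "r \<noteq> t" for r t
      proof -
        have "S r \<inter> S t \<subseteq> {..<N}" using N that by blast
        then show ?thesis by fastforce
      qed
      have sum: "(\<Sum>r\<in>G. \<mu> y (S r \<inter> {N..})) \<le> \<mu> y (\<Union>r\<in>G. S r \<inter> {N..})" if "G \<subseteq> T" for G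
        using finite_subset[OF that T(2)] that
      proof (induction G rule: finite_induct)
        case empty
        then show ?case using nonneg[OF y, of "{}"] by simp
      next
        case (insert r G)
        then have "(S r \<inter> {N..}) \<inter> (\<Union>r\<in>G. S r \<inter> {N..}) = {}" using disj by blast
        then show ?case using insert add[OF y] by simp
      qed
      have "real (card T) * (1 / real (Suc k)) \<le> (\<Sum>r\<in>T. \<mu> y (S r \<inter> {N..}))"
        using T(1) by (intro sum_bounded_below[where K="1 / real (Suc k)", simplified mult.commute]) (auto simp: bad_def)
      also have "\<dots> \<le> \<mu> y (\<Union>r\<in>T. S r \<inter> {N..})" by (rule sum) simp
      also have "\<dots> \<le> \<mu> y UNIV"
        by (rule le_UNIV)
      finally have "real (card T) \<le> real (Suc k) * \<mu> y UNIV" by (simp add: field_simps)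
      then show ?thesis by linarith
    qed
    then show ?thesis using finite_if_finite_subsets_card_bdd by blast
  qed
  then have "countable (\<Union>y\<in>Y. \<Union>k. bad y k)"
    using Y by (intro countable_UN) (auto intro: countable_finite)
  then obtain r where r: "r \<notin> (\<Union>y\<in>Y. \<Union>k. bad y k)"
    using uncountable_UNIV_real by (metis UNIV_eq_I)
  show ?thesis
  proof (rule that[of "S r"])
    show "\<exists>N. \<mu> y (S r \<inter> {N..}) < \<epsilon>" if "y \<in> Y" "\<epsilon> > 0" for y \<epsilon>
    proof -
      obtain k where k: "1 / real (Suc k) < \<epsilon>"
        using reals_Archimedean[OF \<open>\<epsilon> > 0\<close>] by (auto simp: inverse_eq_divide)
      have "r \<notin> bad y k" using r \<open>y \<in> Y\<close> by blast
      then show ?thesis using k by (auto simp: bad_def not_le intro: less_trans)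
    qed
  qed (rule inf)
qed

section \<open>Diagonal projections and compact projections\<close>

lemma diag_eqs:
  "diag A (diag B v) = diag (A \<inter> B) v"
  "A \<inter> B = {} \<Longrightarrow> diag (A \<union> B) v = diag A v + diag B v"
  by (rule ell2_eqI, auto simp: ell2_apply_diag)+

lemma diag_plus_diag_Compl: "v = diag A v + diag (- A) v"
  by (rule ell2_eqI) (simp add: ell2_apply_diag)

lemma diag_Compl: "diag (- A) v = v - diag A v"
  using diag_plus_diag_Compl[of v A] by (simp add: algebra_simps)

lemma inner_diag: "inner (diag A v) w = inner v (diag A w)"
  using inner_adj[OF complex_linear_shift, of A id v w] by (simp add: adj_diag)

lemma cinner_diag: "cinner (diag A v) w = cinner v (diag A w)"
  using cinner_adj[OF complex_linear_shift, of A id v w] by (simp add: adj_diag)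

lemma norm_diag_mono: "A \<subseteq> B \<Longrightarrow> norm (diag A v) \<le> norm (diag B v)"
  using norm_shift_le[of A id "diag B v"] by (simp add: diag_eqs Int_absorb2)

lemma diag_finite: "finite F \<Longrightarrow> diag F v = (\<Sum>y\<in>F. scaleC (ell2_apply v y) (delta y))"
  by (rule ell2_eqI) (simp add: finite_expansion ell2_apply_diag)

lemma apply_diag_finite:
  assumes "finite F" "complex_linear a"
  shows "blinfun_apply a (diag F v) = (\<Sum>y\<in>F. scaleC (ell2_apply v y) (blinfun_apply a (delta y)))"
  using assms(2) by (simp add: diag_finite[OF assms(1)] blinfun.sum_right complex_linear_def)

lemma norm_apply_diag_finite:
  assumes "finite F" "complex_linear a"
  shows "norm (blinfun_apply a (diag F v)) \<le> (\<Sum>y\<in>F. norm (blinfun_apply a (delta y))) * norm v"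
proof -
  have "norm (blinfun_apply a (diag F v)) \<le> (\<Sum>y\<in>F. cmod (ell2_apply v y) * norm (blinfun_apply a (delta y)))"
    unfolding apply_diag_finite[OF assms] by (rule order_trans[OF norm_sum]) (simp add: norm_scaleC)
  also have "\<dots> \<le> (\<Sum>y\<in>F. norm v * norm (blinfun_apply a (delta y)))"
    by (intro sum_mono mult_right_mono cmod_ell2_apply_le) simp
  finally show ?thesis by (simp add: sum_distrib_left mult.commute)
qed

lemma ex_finite_diag_Compl_small:
  assumes "\<epsilon> > 0"
  obtains F where "finite F" "norm (diag (- F) v) \<le> \<epsilon>"
proof -
  obtain F where F: "finite F" "dist (\<Sum>y\<in>F. scaleC (ell2_apply v y) (delta y)) v \<le> \<epsilon>"
    using has_sum_finite_approximation[OF expansion[of v] assms] by auto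
  then have "norm (diag F v - v) \<le> \<epsilon>" by (simp only: dist_norm diag_finite)
  then have "norm (diag (- F) v) \<le> \<epsilon>" by (simp only: diag_Compl norm_minus_commute)
  then show ?thesis using F(1) that by blast
qed

text \<open>Compactness is used only as total boundedness of the image of the unit ball.\<close>

lemma compact_op_finite_cover:
  assumes "compact_op a" "\<epsilon> > 0"
  obtains K where "finite K" "\<And>v. norm v \<le> 1 \<Longrightarrow> \<exists>k\<in>K. norm (blinfun_apply a v - k) < \<epsilon>"
proof -
  let ?K = "closure (blinfun_apply a ` cball 0 1)"
  obtain K where K: "finite K" "?K \<subseteq> (\<Union>k\<in>K. ball k \<epsilon>)"
    using assms compact_eq_totally_bounded[of ?K] unfolding compact_op_def by blast
  have "\<exists>k\<in>K. norm (blinfun_apply a v - k) < \<epsilon>" if "norm v \<le> 1" for v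
  proof -
    have "blinfun_apply a v \<in> ?K" using that by (intro subsetD[OF closure_subset]) simp
    then obtain k where "k \<in> K" "blinfun_apply a v \<in> ball k \<epsilon>" using K(2) by blast
    then show ?thesis by (auto simp: dist_norm norm_minus_commute)
  qed
  then show ?thesis using K(1) that by blast
qed

lemma projection_op_idem: "projection_op p \<Longrightarrow> blinfun_apply p (blinfun_apply p v) = blinfun_apply p v"
  unfolding projection_op_def by (metis blinfun_apply_blinfun_compose)

lemma projection_op_cinner:
  "complex_linear p \<Longrightarrow> projection_op p \<Longrightarrow> cinner (blinfun_apply p v) w = cinner v (blinfun_apply p w)"
  by (simp add: cinner_adj projection_op_def)

lemma projection_op_inner:
  "complex_linear p \<Longrightarrow> projection_op p \<Longrightarrow> inner (blinfun_apply p v) w = inner v (blinfun_apply p w)"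
  by (simp add: inner_eq_Re_cinner projection_op_cinner)

lemma projection_op_norm_le:
  assumes "complex_linear p" "projection_op p"
  shows "norm (blinfun_apply p v) \<le> norm v"
proof -
  have "norm (blinfun_apply p v) * norm (blinfun_apply p v) = inner v (blinfun_apply p v)"
    using projection_op_inner[OF assms, of v "blinfun_apply p v"]
    by (simp add: projection_op_idem[OF assms(2)] power2_norm_eq_inner[symmetric] power2_eq_square)
  also have "\<dots> \<le> norm v * norm (blinfun_apply p v)" by (rule norm_cauchy_schwarz)
  finally show ?thesis by (cases "norm (blinfun_apply p v) = 0") auto
qed

text \<open>Truncating the members of a finite net for the image of the ball gives \<open>\<parallel>diag (- F) p\<parallel> \<le> \<epsilon>\<close>, and
  self-adjointness of \<open>p\<close> transfers this to \<open>p diag (- F)\<close>.\<close>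

lemma compact_projection_tail:
  assumes "complex_linear p" "projection_op p" "compact_op p" "\<epsilon> > 0"
  obtains F where "finite F" "\<And>v. norm (blinfun_apply p (diag (- F) v)) \<le> \<epsilon> * norm v"
proof -
  obtain K where K: "finite K" "\<And>v. norm v \<le> 1 \<Longrightarrow> \<exists>k\<in>K. norm (blinfun_apply p v - k) < \<epsilon> / 2"
    using compact_op_finite_cover[OF assms(3), of "\<epsilon> / 2"] assms(4) by auto
  have "\<forall>k. \<exists>F. finite F \<and> norm (diag (- F) k) \<le> \<epsilon> / 2" for k :: "'a ell2"
    using ex_finite_diag_Compl_small[of "\<epsilon> / 2"] assms(4) by (metis half_gt_zero)
  then obtain G where G: "\<And>k :: 'a ell2. finite (G k)" "\<And>k. norm (diag (- G k) k) \<le> \<epsilon> / 2" by metis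
  define F where "F = (\<Union>k\<in>K. G k)"
  have unit: "norm (diag (- F) (blinfun_apply p v)) \<le> \<epsilon>" if v: "norm v \<le> 1" for v
  proof -
    obtain k where k: "k \<in> K" "norm (blinfun_apply p v - k) < \<epsilon> / 2" using K(2)[OF v] by blast
    have "norm (diag (- F) k) \<le> norm (diag (- G k) k)"
      by (rule norm_diag_mono) (use k(1) in \<open>auto simp: F_def\<close>)
    then have "norm (diag (- F) k) \<le> \<epsilon> / 2" using G(2)[of k] by linarith
    moreover have "norm (diag (- F) (blinfun_apply p v - k)) \<le> \<epsilon> / 2"
      using norm_shift_le[of "- F" id "blinfun_apply p v - k"] k(2) by linarith
    moreover have "diag (- F) (blinfun_apply p v) = diag (- F) (blinfun_apply p v - k) + diag (- F) k"
      by (simp add: blinfun.diff_right)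
    ultimately show ?thesis
      using norm_triangle_ineq[of "diag (- F) (blinfun_apply p v - k)" "diag (- F) k"] by simp
  qed
  have all: "norm (diag (- F) (blinfun_apply p v)) \<le> \<epsilon> * norm v" for v
  proof (cases "v = 0")
    case False
    have "norm (diag (- F) (blinfun_apply p (v /\<^sub>R norm v))) \<le> \<epsilon>" by (rule unit) (use False in simp)
    then show ?thesis using False by (simp add: blinfun.scaleR_right field_simps)
  qed (simp add: blinfun.zero_right)
  have "norm (blinfun_apply p (diag (- F) v)) \<le> \<epsilon> * norm v" for v
  proof -
    let ?w = "blinfun_apply p (diag (- F) v)"
    have "norm ?w * norm ?w = inner ?w ?w"
      by (simp add: power2_norm_eq_inner[symmetric] power2_eq_square)
    also have "\<dots> = inner v (diag (- F) (blinfun_apply p ?w))"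
      by (simp only: projection_op_inner[OF assms(1,2)] inner_diag)
    also have "\<dots> \<le> norm v * norm (diag (- F) (blinfun_apply p ?w))" by (rule norm_cauchy_schwarz)
    also have "\<dots> \<le> norm v * (\<epsilon> * norm ?w)" by (intro mult_left_mono all) simp
    finally have "norm ?w * norm ?w \<le> (\<epsilon> * norm v) * norm ?w" by (simp add: mult_ac)
    then show ?thesis using assms(4) by (cases "norm ?w = 0") auto
  qed
  then show ?thesis using K(1) G(1) by (intro that[of F]) (auto simp: F_def)
qed

lemma not_compact_if_separated_fixed_vectors:
  assumes "infinite A" "\<And>n. n \<in> A \<Longrightarrow> norm (u n) \<le> 1 \<and> blinfun_apply a (u n) = u n" "c > 0"
    and sep: "\<And>n m. n \<in> A \<Longrightarrow> m \<in> A \<Longrightarrow> n \<noteq> m \<Longrightarrow> c \<le> norm (u n - u m)"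
  shows "\<not> compact_op a"
proof
  assume "compact_op a"
  then obtain K where K: "finite K" "\<And>v. norm v \<le> 1 \<Longrightarrow> \<exists>k\<in>K. norm (blinfun_apply a v - k) < c / 2"
    using compact_op_finite_cover[of a "c / 2"] assms(3) by auto
  have "\<forall>n\<in>A. \<exists>k\<in>K. norm (u n - k) < c / 2" using K(2) assms(2) by metis
  then obtain \<kappa> where \<kappa>: "\<And>n. n \<in> A \<Longrightarrow> \<kappa> n \<in> K \<and> norm (u n - \<kappa> n) < c / 2" by metis
  have "inj_on \<kappa> A"
  proof (rule inj_onI, rule ccontr)
    fix n m assume nm: "n \<in> A" "m \<in> A" "\<kappa> n = \<kappa> m" "n \<noteq> m"
    have "norm (u n - u m) \<le> norm (u n - \<kappa> n) + norm (u m - \<kappa> m)"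
      using norm_triangle_ineq4[of "u n - \<kappa> n" "u m - \<kappa> m"] nm(3) by simp
    then show False using \<kappa>[OF nm(1)] \<kappa>[OF nm(2)] sep[OF nm(1,2,4)] by linarith
  qed
  then show False using assms(1) K(1) \<kappa> by (meson finite_subset finite_imageD image_subsetI)
qed

section \<open>Cutting an almost supported projection down to a corner\<close>

text \<open>Let \<open>P = diag Z\<close> and \<open>c = Q (1 - P) Q\<close>, so that \<open>\<parallel>c\<parallel> \<le> 1/4\<close>. The Neumann series
  \<open>S = \<Sum>\<^sub>k Q c\<^sup>k\<close> inverts \<open>Q P Q = Q - c\<close> in the corner of \<open>Q\<close>. Since \<open>S P S = S\<close>, the operator \<open>P S P\<close> is
  a projection, namely the one onto the range of \<open>P Q\<close>. This replaces functional calculus by norm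
  convergence, which keeps \<open>S\<close> inside the uniform Roe algebra.\<close>

lemma ex_corner_inverse:
  assumes Y: "Metric_space Y e" and Q: "Q \<in> uniform_Roe Y e" "projection_op Q" and "Z \<subseteq> Y"
    and small: "\<And>v. norm (blinfun_apply Q (diag (- Z) v)) \<le> norm v / 4"
  obtains S where "S \<in> uniform_Roe Y e" "adj S = S" "S o\<^sub>L Q = S"
    "\<And>v. blinfun_apply S (diag Z (blinfun_apply Q v)) = blinfun_apply Q v"
proof -
  define c where "c = (Q o\<^sub>L Q) - (Q o\<^sub>L diag Z o\<^sub>L Q)"
  define t where "t k = ((\<lambda>a. a o\<^sub>L c) ^^ k) Q" for k
  have t0: "t 0 = Q" and tSuc: "t (Suc k) = t k o\<^sub>L c" for k by (simp_all add: t_def)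
  note lin = uniform_Roe_complex_linear[OF Q(1)]
  note idem = projection_op_idem[OF Q(2)]
  have c_apply: "blinfun_apply c v = blinfun_apply Q v - blinfun_apply Q (diag Z (blinfun_apply Q v))" for v
    by (simp add: c_def blinfun.diff_left idem)
  have "norm (blinfun_apply c v) \<le> 1 / 4 * norm v" for v
  proof -
    have "blinfun_apply c v = blinfun_apply Q (diag (- Z) (blinfun_apply Q v))"
      by (simp add: c_apply diag_Compl blinfun.diff_right idem)
    then show ?thesis
      using small[of "blinfun_apply Q v"] projection_op_norm_le[OF lin Q(2), of v] by simp
  qed
  then have nc: "norm c \<le> 1 / 4" by (intro norm_blinfun_bound) simp_all
  have nt: "norm (t k) \<le> (1 / 4) ^ k" for k
  proof (induction k)
    case 0
    show ?case unfolding t0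
      by (rule norm_blinfun_bound) (use projection_op_norm_le[OF lin Q(2)] in simp_all)
  next
    case (Suc k)
    have "norm (t (Suc k)) \<le> norm (t k) * norm c" unfolding tSuc by (rule norm_blinfun_compose)
    also have "\<dots> \<le> (1 / 4) ^ k * (1 / 4)" by (intro mult_mono Suc nc) simp_all
    finally show ?case by simp
  qed
  have summ: "summable t"
    by (rule summable_comparison_test[of _ "\<lambda>k. (1 / 4) ^ k"]) (use nt in \<open>auto intro: summable_geometric\<close>)
  define S where "S = suminf t"
  have comp: "S o\<^sub>L a = (\<Sum>k. t k o\<^sub>L a)" for a
    unfolding S_def
    by (rule bounded_linear.suminf[OF bounded_bilinear.bounded_linear_left[OF bounded_bilinear_blinfun_compose] summ])
  have Sc: "S o\<^sub>L c = S - Q"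
    unfolding comp tSuc[symmetric] using suminf_split_head[OF summ] by (simp add: S_def t0)
  have "t k o\<^sub>L Q = t k" for k
    by (cases k) (auto simp: t0 tSuc c_apply idem blinfun.diff_right intro!: blinfun_eqI)
  then have SQ: "S o\<^sub>L Q = S" unfolding comp by (simp add: S_def)
  then have SQv: "blinfun_apply S (blinfun_apply Q v) = blinfun_apply S v" for v
    by (metis blinfun_apply_blinfun_compose)
  have SPQ: "blinfun_apply S (diag Z (blinfun_apply Q v)) = blinfun_apply Q v" for v
  proof -
    have "blinfun_apply S (diag Z (blinfun_apply Q v))
        = blinfun_apply S (blinfun_apply Q v - blinfun_apply c v)"
      by (simp add: c_apply SQv)
    also have "\<dots> = blinfun_apply S v - blinfun_apply (S o\<^sub>L c) v"
      by (simp add: blinfun.diff_right SQv)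
    finally show ?thesis by (simp add: Sc blinfun.diff_left)
  qed
  have cR: "c \<in> uniform_Roe Y e"
    unfolding c_def using assms by (intro uniform_Roe_diff uniform_Roe_compose diag_in_uniform_Roe)
  have tR: "t k \<in> uniform_Roe Y e" for k
    by (induction k) (simp_all add: t0 tSuc Q(1) uniform_Roe_compose[OF Y] cR)
  have SR: "S \<in> uniform_Roe Y e"
  proof (rule closed_sequentially[OF closed_uniform_Roe])
    show "(\<lambda>n. \<Sum>k<n. t k) \<longlonglongrightarrow> S" unfolding S_def by (rule summable_LIMSEQ[OF summ])
    show "(\<Sum>k<n. t k) \<in> uniform_Roe Y e" for n
    proof (induction n)
      case 0
      have "t 0 - t 0 \<in> uniform_Roe Y e" by (intro uniform_Roe_diff tR)
      then show ?case by simp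
    qed (simp add: uniform_Roe_add tR)
  qed
  note Slin = uniform_Roe_complex_linear[OF SR]
  \<comment> \<open>The adjoint of \<open>S P Q = Q\<close> is \<open>Q P S\<^sup>* = Q\<close>; hence \<open>S = S Q = S P S\<^sup>* = S\<^sup>*\<close>.\<close>
  have "adj S = S"
  proof (rule blinfun_eqI)
    fix g
    note Qc = projection_op_cinner[OF lin Q(2)]
    have 1: "blinfun_apply Q (blinfun_apply (adj S) g) = blinfun_apply (adj S) g"
      by (rule cinner_right_eqI) (simp add: Qc[symmetric] cinner_adj[OF Slin, symmetric] SQv)
    have 2: "blinfun_apply Q (diag Z (blinfun_apply (adj S) g)) = blinfun_apply Q g"
      by (rule cinner_right_eqI)
        (simp add: Qc[symmetric] cinner_diag[symmetric] cinner_adj[OF Slin, symmetric] SPQ)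
    have "blinfun_apply S g = blinfun_apply S (blinfun_apply Q (diag Z (blinfun_apply (adj S) g)))"
      by (simp add: 2 SQv)
    also have "\<dots> = blinfun_apply S (diag Z (blinfun_apply Q (blinfun_apply (adj S) g)))"
      by (simp only: SQv 1)
    also have "\<dots> = blinfun_apply Q (blinfun_apply (adj S) g)" by (rule SPQ)
    also have "\<dots> = blinfun_apply (adj S) g" by (rule 1)
    finally show "blinfun_apply (adj S) g = blinfun_apply S g" by simp
  qed
  then show ?thesis using SR SQ SPQ that by blast
qed

section \<open>Compact preserving embeddings\<close>

lemma finite_neighbourhood:
  assumes "Metric_space Y e" "unif_locally_finite Y e" "finite F" "F \<subseteq> Y"
  shows "finite {z \<in> Y. \<exists>y\<in>F. e y z \<le> r}"
proof (rule finite_subset)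
  interpret Metric_space Y e by fact
  show "{z \<in> Y. \<exists>y\<in>F. e y z \<le> r} \<subseteq> (\<Union>y\<in>F. mcball y (max r 1))"
  proof
    fix z assume "z \<in> {z \<in> Y. \<exists>y\<in>F. e y z \<le> r}"
    then obtain y where "z \<in> Y" "y \<in> F" "e y z \<le> max r 1" by fastforce
    then show "z \<in> (\<Union>y\<in>F. mcball y (max r 1))" using assms(4) by auto
  qed
  have "max r 1 > 0" by simp
  then have "\<forall>y\<in>Y. finite (mcball y (max r 1))"
    using assms(2) unfolding unif_locally_finite_def by blast
  then show "finite (\<Union>y\<in>F. mcball y (max r 1))" using assms(3,4) by blast
qed

text \<open>A space with finite balls is the union of the balls of integer radius around one point.\<close>

lemma countable_if_unif_locally_finite:
  assumes "Metric_space Y e" "unif_locally_finite Y e"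
  shows "countable Y"
proof (cases "Y = {}")
  case False
  then obtain y where "y \<in> Y" by blast
  have "finite {z \<in> Y. \<exists>x\<in>{y}. e x z \<le> real n}" for n
    by (rule finite_neighbourhood[OF assms]) (use \<open>y \<in> Y\<close> in auto)
  then have "countable (\<Union>n. {z \<in> Y. \<exists>x\<in>{y}. e x z \<le> real n})"
    by (intro countable_UN) (auto intro: countable_finite)
  moreover have "Y \<subseteq> (\<Union>n. {z \<in> Y. \<exists>x\<in>{y}. e x z \<le> real n})"
    using real_arch_simple by auto
  ultimately show ?thesis by (rule countable_subset[rotated])
qed simp

text \<open>The image of the unit ball lies in a compact disc of scalar multiples of \<open>\<delta>\<^sub>x\<close>.\<close>

lemma compact_op_diag_singleton: "compact_op (diag {x})"
proof -
  let ?C = "(\<lambda>c. scaleC c (delta x)) ` cball 0 1"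
  have "bounded_linear (\<lambda>c. scaleC c (delta x))"
  proof (rule bounded_linear_intro)
    show "scaleC (a + b) (delta x) = scaleC a (delta x) + scaleC b (delta x)" for a b
      by (rule ell2_eqI) (simp add: algebra_simps)
    show "scaleC (r *\<^sub>R a) (delta x) = r *\<^sub>R scaleC a (delta x)" for r a
      by (rule ell2_eqI) (simp add: scaleR_conv_of_real)
    show "norm (scaleC a (delta x)) \<le> norm a * 1" for a by (simp add: norm_scaleC)
  qed
  then have "continuous_on (cball 0 1) (\<lambda>c. scaleC c (delta x))"
    by (rule bounded_linear.continuous_on[OF _ continuous_on_id])
  then have C: "compact ?C" by (rule compact_continuous_image) (rule compact_cball)
  have "diag {x} ` cball 0 1 \<subseteq> ?C"
  proof
    fix w assume "w \<in> diag {x} ` cball 0 1"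
    then obtain v where v: "norm v \<le> 1" "w = diag {x} v" by auto
    have "w = scaleC (ell2_apply v x) (delta x)" by (simp add: v(2) diag_finite)
    then show "w \<in> ?C"
      using cmod_ell2_apply_le[of v x] v(1) by (intro image_eqI[of _ _ "ell2_apply v x"]) auto
  qed
  then have "closure (diag {x} ` cball 0 1) \<subseteq> ?C"
    by (rule closure_minimal) (rule compact_imp_closed[OF C])
  then show ?thesis
    unfolding compact_op_def using compact_Int_closed[OF C closed_closure] by (metis Int_absorb1)
qed

locale compact_Roe_embedding =
  fixes X :: "'a set" and d :: "'a \<Rightarrow> 'a \<Rightarrow> real" and Y :: "'b set" and e :: "'b \<Rightarrow> 'b \<Rightarrow> real"
    and \<Phi> :: "('a ell2 \<Rightarrow>\<^sub>L 'a ell2) \<Rightarrow> ('b ell2 \<Rightarrow>\<^sub>L 'b ell2)"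
  assumes metric_X: "Metric_space X d" and ulf_X: "unif_locally_finite X d"
    and metric_Y: "Metric_space Y e" and ulf_Y: "unif_locally_finite Y e"
    and embedding: "Roe_embedding X d Y e \<Phi>" and compact_pres: "compact_preserving X d \<Phi>"
begin

text \<open>A finitely additive projection-valued measure on \<open>X\<close>; countable additivity may fail.\<close>

definition E :: "'a set \<Rightarrow> 'b ell2 \<Rightarrow>\<^sub>L 'b ell2" where
  "E A = \<Phi> (diag A)"

lemma Phi_in: "a \<in> uniform_Roe X d \<Longrightarrow> \<Phi> a \<in> uniform_Roe Y e"
  using embedding unfolding Roe_embedding_def by blast

lemma Phi_inj: "a \<in> uniform_Roe X d \<Longrightarrow> b \<in> uniform_Roe X d \<Longrightarrow> \<Phi> a = \<Phi> b \<Longrightarrow> a = b"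
  using embedding unfolding Roe_embedding_def by (meson inj_onD)

lemma Phi_add: "a \<in> uniform_Roe X d \<Longrightarrow> b \<in> uniform_Roe X d \<Longrightarrow> \<Phi> (a + b) = \<Phi> a + \<Phi> b"
  using embedding unfolding Roe_embedding_def by blast

lemma Phi_compose:
  assumes "a \<in> uniform_Roe X d" "b \<in> uniform_Roe X d"
  shows "blinfun_apply (\<Phi> (a o\<^sub>L b)) v = blinfun_apply (\<Phi> a) (blinfun_apply (\<Phi> b) v)"
proof -
  have "\<Phi> (a o\<^sub>L b) = \<Phi> a o\<^sub>L \<Phi> b" using embedding assms unfolding Roe_embedding_def by blast
  then show ?thesis by simp
qed

lemma Phi_adj: "a \<in> uniform_Roe X d \<Longrightarrow> \<Phi> (adj a) = adj (\<Phi> a)"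
  using embedding unfolding Roe_embedding_def by blast

lemma cinner_Phi:
  "a \<in> uniform_Roe X d \<Longrightarrow> cinner (blinfun_apply (\<Phi> a) v) w = cinner v (blinfun_apply (\<Phi> (adj a)) w)"
  by (simp add: Phi_adj cinner_adj uniform_Roe_complex_linear[OF Phi_in])

lemma diag_in: "A \<subseteq> X \<Longrightarrow> diag A \<in> uniform_Roe X d"
  by (rule diag_in_uniform_Roe[OF metric_X])

lemma E_in: "A \<subseteq> X \<Longrightarrow> E A \<in> uniform_Roe Y e"
  unfolding E_def by (intro Phi_in diag_in)

lemma E_complex_linear: "A \<subseteq> X \<Longrightarrow> complex_linear (E A)"
  by (rule uniform_Roe_complex_linear[OF E_in])

lemma E_E:
  assumes "A \<subseteq> X" "B \<subseteq> X"
  shows "blinfun_apply (E A) (blinfun_apply (E B) v) = blinfun_apply (E (A \<inter> B)) v"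
proof -
  have "diag A o\<^sub>L diag B = diag (A \<inter> B)" by (rule blinfun_eqI) (simp add: diag_eqs)
  then show ?thesis using Phi_compose[OF diag_in[OF assms(1)] diag_in[OF assms(2)]] by (simp add: E_def)
qed

lemma E_projection: "A \<subseteq> X \<Longrightarrow> projection_op (E A)"
  unfolding projection_op_def
  using Phi_adj[OF diag_in, of A] by (auto simp: E_E adj_diag E_def[symmetric] intro!: blinfun_eqI)

lemma E_Un:
  assumes "A \<subseteq> X" "B \<subseteq> X" "A \<inter> B = {}"
  shows "blinfun_apply (E (A \<union> B)) v = blinfun_apply (E A) v + blinfun_apply (E B) v"
proof -
  have "diag (A \<union> B) = diag A + diag B"
    by (rule blinfun_eqI) (simp add: diag_eqs(2)[OF assms(3)] blinfun.add_left)
  then show ?thesis using Phi_add[OF diag_in[OF assms(1)] diag_in[OF assms(2)]]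
    by (simp add: E_def blinfun.add_left)
qed

lemma E_empty: "blinfun_apply (E {}) v = 0"
  using E_Un[of "{}" "{}" v] by simp

lemma E_inner: "A \<subseteq> X \<Longrightarrow> inner (blinfun_apply (E A) v) w = inner v (blinfun_apply (E A) w)"
  by (rule projection_op_inner[OF E_complex_linear E_projection])

lemma E_norm_le: "A \<subseteq> X \<Longrightarrow> norm (blinfun_apply (E A) v) \<le> norm v"
  by (rule projection_op_norm_le[OF E_complex_linear E_projection])

lemma E_orthogonal:
  assumes "A \<subseteq> X" "B \<subseteq> X" "A \<inter> B = {}"
  shows "inner (blinfun_apply (E A) v) (blinfun_apply (E B) w) = 0"
  by (simp add: E_inner assms E_E E_empty)

lemma E_norm_mono:
  assumes "A \<subseteq> B" "B \<subseteq> X"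
  shows "norm (blinfun_apply (E A) v) \<le> norm (blinfun_apply (E B) v)"
proof -
  have "blinfun_apply (E A) v = blinfun_apply (E A) (blinfun_apply (E B) v)"
    using assms by (subst E_E) (auto simp: Int_absorb2)
  then show ?thesis using E_norm_le[of A "blinfun_apply (E B) v"] assms by simp
qed

lemma E_norm_square_Un:
  assumes "A \<subseteq> X" "B \<subseteq> X" "A \<inter> B = {}"
  shows "(norm (blinfun_apply (E (A \<union> B)) v))\<^sup>2
    = (norm (blinfun_apply (E A) v))\<^sup>2 + (norm (blinfun_apply (E B) v))\<^sup>2"
  using E_orthogonal[OF assms, of v v]
  by (simp add: E_Un[OF assms] power2_norm_eq_inner inner_add_left inner_add_right inner_commute)

lemma E_outside: "A \<subseteq> X \<Longrightarrow> y \<notin> Y \<Longrightarrow> blinfun_apply (E A) (delta y) = 0"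
  by (rule bounded_ops_delta_outside[OF uniform_Roe_bounded_ops[OF E_in]])

lemma E_singleton_compact: "x \<in> X \<Longrightarrow> compact_op (E {x})"
  using compact_pres diag_in[of "{x}"] compact_op_diag_singleton[of x]
  unfolding compact_preserving_def E_def by blast

lemma E_singleton_nonzero:
  assumes "x \<in> X"
  obtains y where "y \<in> Y" "blinfun_apply (E {x}) (delta y) \<noteq> 0"
proof -
  have "\<exists>y. blinfun_apply (E {x}) (delta y) \<noteq> 0"
  proof (rule ccontr)
    assume 0: "\<not> ?thesis"
    have "blinfun_apply (E {x}) v = 0" for v
      using operator_expansion[OF E_complex_linear, of "{x}" v] 0 assms
        has_sum_unique[OF _ has_sum_0_simp] by simp
    then have "E {x} = E {}" by (intro blinfun_eqI) (simp add: E_empty)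
    then have "diag {x} = diag {}" unfolding E_def using assms by (intro Phi_inj diag_in) auto
    then have "diag {x} (delta x) = diag {} (delta x)" by simp
    then have "norm (delta x :: 'a ell2) = 0" by (simp add: shift_delta)
    then show False by simp
  qed
  then show ?thesis using that E_outside assms by (metis empty_subsetI insert_subset)
qed

lemma E_finite_norm_le:
  assumes "finite B" "B \<subseteq> X"
  shows "norm (blinfun_apply (E B) v) \<le> (\<Sum>x\<in>B. norm (blinfun_apply (E {x}) v))"
  using assms
proof (induction B rule: finite_induct)
  case (insert x B)
  have "blinfun_apply (E (insert x B)) v = blinfun_apply (E {x}) v + blinfun_apply (E B) v"
    using E_Un[of "{x}" B v] insert by simp
  then show ?case
    using norm_triangle_ineq[of "blinfun_apply (E {x}) v" "blinfun_apply (E B) v"] insert by simp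
qed (simp add: E_empty)

text \<open>For each \<open>y\<close> the map \<open>A \<mapsto> \<parallel>E A \<delta>\<^sub>y\<parallel>\<^sup>2\<close> is a finitely additive measure, by Pythagoras, and \<open>Y\<close> is
  countable. As the \<open>E A\<close> are contractions, convergence on basis vectors extends to all vectors.\<close>

lemma ex_tail_null_subsequence:
  fixes s :: "nat \<Rightarrow> 'a"
  assumes s: "inj s" "range s \<subseteq> X"
  obtains A where "infinite A" "\<And>v. (\<lambda>N. blinfun_apply (E (s ` (A \<inter> {N..}))) v) \<longlonglongrightarrow> 0"
proof -
  note sX = order_trans[OF image_mono[OF subset_UNIV] s(2)]
  obtain A where A: "infinite A"
    "\<And>y \<epsilon>. y \<in> Y \<Longrightarrow> \<epsilon> > 0 \<Longrightarrow> \<exists>N. (norm (blinfun_apply (E (s ` (A \<inter> {N..}))) (delta y)))\<^sup>2 < \<epsilon>"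
  proof (rule ex_infinite_tail_null[of Y "\<lambda>y B. (norm (blinfun_apply (E (s ` B)) (delta y)))\<^sup>2"])
    show "countable Y" by (rule countable_if_unif_locally_finite[OF metric_Y ulf_Y])
    show "(norm (blinfun_apply (E (s ` (B \<union> C))) (delta y)))\<^sup>2
        = (norm (blinfun_apply (E (s ` B)) (delta y)))\<^sup>2 + (norm (blinfun_apply (E (s ` C)) (delta y)))\<^sup>2"
      if "B \<inter> C = {}" for y B C
      unfolding image_Un
      by (rule E_norm_square_Un[OF sX sX]) (use that s(1) in \<open>simp flip: image_Int\<close>)
  qed auto
  define T where "T N = E (s ` (A \<inter> {N..}))" for N
  have Tlin: "complex_linear (T N)" for N unfolding T_def by (rule E_complex_linear[OF sX])
  have Tdelta: "(\<lambda>N. blinfun_apply (T N) (delta y)) \<longlonglongrightarrow> 0" for y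
  proof (cases "y \<in> Y")
    case True
    show ?thesis
    proof (rule LIMSEQ_I)
      fix r :: real assume "r > 0"
      obtain N where N: "(norm (blinfun_apply (T N) (delta y)))\<^sup>2 < r\<^sup>2"
        using A(2)[OF True, of "r\<^sup>2"] \<open>r > 0\<close> by (auto simp: T_def)
      have "norm (blinfun_apply (T n) (delta y)) < r" if "n \<ge> N" for n
      proof -
        have "norm (blinfun_apply (T n) (delta y)) \<le> norm (blinfun_apply (T N) (delta y))"
          unfolding T_def by (rule E_norm_mono[OF _ sX]) (use that in auto)
        moreover have "norm (blinfun_apply (T N) (delta y)) < r"
          by (rule power2_less_imp_less[OF N]) (use \<open>r > 0\<close> in simp)
        ultimately show ?thesis by linarith
      qed
      then show "\<exists>N. \<forall>n\<ge>N. norm (blinfun_apply (T n) (delta y) - 0) < r" by auto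
    qed
  next
    case False
    then have "blinfun_apply (T N) (delta y) = 0" for N unfolding T_def by (rule E_outside[OF sX])
    then show ?thesis by simp
  qed
  have "(\<lambda>N. blinfun_apply (T N) v) \<longlonglongrightarrow> 0" for v
  proof (rule LIMSEQ_I)
    fix r :: real assume "r > 0"
    obtain F where F: "finite F" "norm (diag (- F) v) \<le> r / 2"
      using ex_finite_diag_Compl_small[of "r / 2" v] \<open>r > 0\<close> by auto
    have "(\<lambda>N. blinfun_apply (T N) (diag F v)) \<longlonglongrightarrow> (\<Sum>y\<in>F. scaleC (ell2_apply v y) 0)"
      unfolding apply_diag_finite[OF F(1) Tlin]
      by (intro tendsto_sum bounded_linear.tendsto[OF bounded_linear_scaleC] Tdelta)
    then obtain N where N: "\<And>n. n \<ge> N \<Longrightarrow> norm (blinfun_apply (T n) (diag F v)) < r / 2"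
      using LIMSEQ_D[of _ 0 "r / 2"] \<open>r > 0\<close> by fastforce
    have "norm (blinfun_apply (T n) v) < r" if "n \<ge> N" for n
    proof -
      have "blinfun_apply (T n) v = blinfun_apply (T n) (diag F v) + blinfun_apply (T n) (diag (- F) v)"
        by (simp add: diag_Compl blinfun.diff_right)
      moreover have "norm (blinfun_apply (T n) (diag (- F) v)) \<le> r / 2"
        using E_norm_le[OF sX, of "A \<inter> {n..}" "diag (- F) v"] F(2) by (simp add: T_def)
      ultimately show ?thesis
        using N[OF that] norm_triangle_ineq[of "blinfun_apply (T n) (diag F v)"
            "blinfun_apply (T n) (diag (- F) v)"] by simp
    qed
    then show "\<exists>N. \<forall>n\<ge>N. norm (blinfun_apply (T n) v - 0) < r" by auto
  qed
  then show ?thesis using A(1) that unfolding T_def by blast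
qed

text \<open>The form in which strong continuity along the subsequence \<open>s ` A\<close> is used: bounds for the single
  projections \<open>E {s n}\<close> may be added up.\<close>

definition countably_subadditive :: "(nat \<Rightarrow> 'a) \<Rightarrow> nat set \<Rightarrow> bool" where
  "countably_subadditive s A \<longleftrightarrow> (\<forall>B v b. B \<subseteq> A \<longrightarrow> summable b \<longrightarrow> (\<forall>n. 0 \<le> b n) \<longrightarrow>
     (\<forall>n\<in>B. norm (blinfun_apply (E {s n}) v) \<le> b n) \<longrightarrow> norm (blinfun_apply (E (s ` B)) v) \<le> suminf b)"

lemma countably_subadditiveD:
  assumes "countably_subadditive s A" "B \<subseteq> A" "b sums t" "\<And>n. 0 \<le> b n"
    and "\<And>n. n \<in> B \<Longrightarrow> norm (blinfun_apply (E {s n}) v) \<le> b n"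
  shows "norm (blinfun_apply (E (s ` B)) v) \<le> t"
  using assms sums_summable[OF assms(3)] sums_unique[OF assms(3)]
  unfolding countably_subadditive_def by blast

lemma ex_countably_subadditive_subsequence:
  fixes s :: "nat \<Rightarrow> 'a"
  assumes s: "inj s" "range s \<subseteq> X"
  obtains A where "infinite A" "countably_subadditive s A"
proof -
  note sX = order_trans[OF image_mono[OF subset_UNIV] s(2)]
  obtain A where A: "infinite A" "\<And>v. (\<lambda>N. blinfun_apply (E (s ` (A \<inter> {N..}))) v) \<longlonglongrightarrow> 0"
    using ex_tail_null_subsequence[OF s] by blast
  have sub: "norm (blinfun_apply (E (s ` B)) v) \<le> suminf b"
    if B: "B \<subseteq> A" and b: "summable b" "\<And>n. 0 \<le> b n"
      and le: "\<And>n. n \<in> B \<Longrightarrow> norm (blinfun_apply (E {s n}) v) \<le> b n" for B v b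
  proof (rule field_le_epsilon)
    fix \<epsilon> :: real assume "\<epsilon> > 0"
    then obtain N where N: "norm (blinfun_apply (E (s ` (A \<inter> {N..}))) v) < \<epsilon>"
      using LIMSEQ_D[OF A(2)[of v], of \<epsilon>] by auto
    have "B = (B \<inter> {..<N}) \<union> (B \<inter> {N..})" by auto
    then have "s ` B = s ` (B \<inter> {..<N}) \<union> s ` (B \<inter> {N..})" by (metis image_Un)
    moreover have "s ` (B \<inter> {..<N}) \<inter> s ` (B \<inter> {N..}) = {}" using s(1) by (auto dest: injD)
    ultimately have "blinfun_apply (E (s ` B)) v
        = blinfun_apply (E (s ` (B \<inter> {..<N}))) v + blinfun_apply (E (s ` (B \<inter> {N..}))) v"
      using E_Un[OF sX sX] by metis
    then have "norm (blinfun_apply (E (s ` B)) v)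
        \<le> norm (blinfun_apply (E (s ` (B \<inter> {..<N}))) v) + norm (blinfun_apply (E (s ` (B \<inter> {N..}))) v)"
      by (simp add: norm_triangle_ineq)
    also have "norm (blinfun_apply (E (s ` (B \<inter> {..<N}))) v)
        \<le> (\<Sum>x\<in>s ` (B \<inter> {..<N}). norm (blinfun_apply (E {x}) v))"
      by (rule E_finite_norm_le[OF _ sX]) simp
    also have "\<dots> = (\<Sum>n\<in>B \<inter> {..<N}. norm (blinfun_apply (E {s n}) v))"
      by (rule sum.reindex[unfolded o_def]) (use s(1) in \<open>rule inj_on_subset, simp\<close>)
    also have "\<dots> \<le> (\<Sum>n\<in>B \<inter> {..<N}. b n)" by (rule sum_mono) (simp add: le)
    also have "\<dots> \<le> suminf b" by (rule sum_le_suminf[OF b(1)]) (auto simp: b(2))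
    also have "norm (blinfun_apply (E (s ` (B \<inter> {N..}))) v) \<le> norm (blinfun_apply (E (s ` (A \<inter> {N..}))) v)"
      by (rule E_norm_mono[OF _ sX]) (use B in auto)
    also have "\<dots> \<le> \<epsilon>" using N by simp
    finally show "norm (blinfun_apply (E (s ` B)) v) \<le> suminf b + \<epsilon>" by simp
  qed
  then have "countably_subadditive s A" unfolding countably_subadditive_def by blast
  with A(1) show ?thesis by (rule that)
qed

lemma E_singleton_tail:
  assumes "x \<in> X" "\<epsilon> > 0"
  obtains F where "finite F" "F \<subseteq> Y" "\<And>v. norm (blinfun_apply (E {x}) (diag (- F) v)) \<le> \<epsilon> * norm v"
proof -
  have x: "{x} \<subseteq> X" using assms by simp
  obtain F where F: "finite F" "\<And>v. norm (blinfun_apply (E {x}) (diag (- F) v)) \<le> \<epsilon> * norm v"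
    using compact_projection_tail[OF E_complex_linear[OF x] E_projection[OF x] E_singleton_compact assms(2)]
      assms(1) by blast
  have "blinfun_apply (E {x}) (diag (- (F \<inter> Y)) v) = blinfun_apply (E {x}) (diag (- F) v)" for v
  proof -
    have "diag (- (F \<inter> Y)) v - diag (- F) v \<in> ell2_on (- Y)"
      by (simp add: ell2_on_def ell2_apply_diag)
    then have "blinfun_apply (E {x}) (diag (- (F \<inter> Y)) v - diag (- F) v) = 0"
      using uniform_Roe_bounded_ops[OF E_in[OF x]] by (simp add: bounded_ops_def)
    then show ?thesis by (simp add: blinfun.diff_right)
  qed
  then show ?thesis using F by (intro that[of "F \<inter> Y"]) auto
qed

lemma E_singleton_delta_small:
  assumes "x \<in> X" "\<epsilon> > 0"
  obtains F where "finite F" "F \<subseteq> Y" "\<And>y. y \<notin> F \<Longrightarrow> norm (blinfun_apply (E {x}) (delta y)) \<le> \<epsilon>"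
proof -
  obtain F where F: "finite F" "F \<subseteq> Y" "\<And>v. norm (blinfun_apply (E {x}) (diag (- F) v)) \<le> \<epsilon> * norm v"
    using E_singleton_tail[OF assms] by blast
  have "norm (blinfun_apply (E {x}) (delta y)) \<le> \<epsilon>" if "y \<notin> F" for y
    using F(3)[of "delta y"] that by (simp add: shift_delta)
  then show ?thesis using F that by blast
qed

section \<open>A uniform lower bound from compactness of ghost projections\<close>

text \<open>If the norms \<open>\<parallel>E {x} \<delta>\<^sub>y\<parallel>\<close> are not bounded below, \<open>x\<close> can be chosen so that they are tiny for
  all \<open>y\<close>, in particular on a prescribed finite set \<open>G\<close>: removing \<open>G\<close> from an approximate support of
  \<open>E {x}\<close> costs little. With \<open>G\<close> a large neighbourhood of the supports chosen before, the new support
  is far from them. The constants \<open>1/8 * (1/2)^n\<close> add up to \<open>1/4\<close>, the bound on which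
  \<open>ex_corner_inverse\<close> relies.\<close>

lemma ex_spread_out_sequence:
  assumes "\<And>\<delta>. \<delta> > 0 \<Longrightarrow> \<exists>x\<in>X. \<forall>y\<in>Y. norm (blinfun_apply (E {x}) (delta y)) < \<delta>"
  obtains s :: "nat \<Rightarrow> 'a" and F :: "nat \<Rightarrow> 'b set" where
    "inj s" "range s \<subseteq> X" "\<And>n. finite (F n)" "\<And>n. F n \<subseteq> Y"
    "\<And>n y. norm (blinfun_apply (E {s n}) (delta y)) \<le> (1 / 4) ^ n"
    "\<And>n v. norm (blinfun_apply (E {s n}) (diag (- F n) v)) \<le> 1 / 8 * (1 / 2) ^ n * norm v"
    "\<And>m n y z. m < n \<Longrightarrow> y \<in> F m \<Longrightarrow> z \<in> F n \<Longrightarrow> e y z > real n"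
proof -
  define V where "V n p \<longleftrightarrow> fst p \<in> X \<and> finite (snd p) \<and> snd p \<subseteq> Y \<and>
    (\<forall>y. norm (blinfun_apply (E {fst p}) (delta y)) \<le> (1 / 4) ^ n) \<and>
    (\<forall>v. norm (blinfun_apply (E {fst p}) (diag (- snd p) v)) \<le> 1 / 8 * (1 / 2) ^ n * norm v)"
    for n :: nat and p
  define R where "R n p q \<longleftrightarrow> fst p \<noteq> fst q \<and> (\<forall>y\<in>snd p. \<forall>z\<in>snd q. e y z > real n)"
    for n :: nat and p q :: "'a \<times> 'b set"
  have step: "\<exists>q. V n q \<and> (\<forall>m<n. R n (h m) q)" if h: "\<And>m. m < n \<Longrightarrow> V m (h m)" for n h
  proof -
    have "\<forall>m\<in>{..<n}. \<exists>y\<in>Y. blinfun_apply (E {fst (h m)}) (delta y) \<noteq> 0"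
      using h E_singleton_nonzero unfolding V_def by (metis lessThan_iff)
    then obtain y where y: "\<And>m. m < n \<Longrightarrow> y m \<in> Y \<and> blinfun_apply (E {fst (h m)}) (delta (y m)) \<noteq> 0"
      by (metis lessThan_iff)
    define G where "G = {z \<in> Y. \<exists>y\<in>(\<Union>m<n. snd (h m)). e y z \<le> real n}"
    have G: "finite G"
      unfolding G_def by (rule finite_neighbourhood[OF metric_Y ulf_Y]) (use h in \<open>auto simp: V_def\<close>)
    \<comment> \<open>Half of the allowed error is for the approximate support \<open>F\<close>, half for removing \<open>G\<close> from it.\<close>
    define \<epsilon> :: real where "\<epsilon> = 1 / 16 * (1 / 2) ^ n"
    have \<epsilon>: "\<epsilon> > 0" by (simp add: \<epsilon>_def)
    \<comment> \<open>The last entries of \<open>D\<close> force \<open>x\<close> to differ from the earlier points, whose projections do not vanish at \<open>y m\<close>.\<close>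
    define D where "D = insert ((1 / 4) ^ n) (insert (\<epsilon> / (card G + 1))
      ((\<lambda>m. norm (blinfun_apply (E {fst (h m)}) (delta (y m)))) ` {..<n}))"
    have D: "finite D" "D \<noteq> {}" by (simp_all add: D_def)
    have "Min D > 0" using D y \<epsilon> by (auto simp: D_def)
    then obtain x where x: "x \<in> X" and lt: "\<And>y. y \<in> Y \<Longrightarrow> norm (blinfun_apply (E {x}) (delta y)) < Min D"
      using assms by blast
    have le: "norm (blinfun_apply (E {x}) (delta y)) \<le> t" if "t \<in> D" for y t
    proof (cases "y \<in> Y")
      case True
      then show ?thesis using lt[of y] Min_le[OF D(1) that] by linarith
    next
      case False
      then show ?thesis using E_outside[of "{x}" y] x \<open>Min D > 0\<close> Min_le[OF D(1) that] by simp
    qed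
    obtain F where F: "finite F" "F \<subseteq> Y" "\<And>v. norm (blinfun_apply (E {x}) (diag (- F) v)) \<le> \<epsilon> * norm v"
      using E_singleton_tail[OF x \<epsilon>] by blast
    have x': "{x} \<subseteq> X" using x by simp
    have diag: "norm (blinfun_apply (E {x}) (diag (- (F - G)) v)) \<le> 1 / 8 * (1 / 2) ^ n * norm v" for v
    proof -
      have "diag (- (F - G)) v = diag (- F) v + diag (F \<inter> G) v"
        by (rule ell2_eqI) (simp add: ell2_apply_diag)
      then have "norm (blinfun_apply (E {x}) (diag (- (F - G)) v))
          \<le> norm (blinfun_apply (E {x}) (diag (- F) v)) + norm (blinfun_apply (E {x}) (diag (F \<inter> G) v))"
        by (simp add: blinfun.add_right norm_triangle_ineq)
      also have "\<dots> \<le> \<epsilon> * norm v + (\<Sum>y\<in>F \<inter> G. norm (blinfun_apply (E {x}) (delta y))) * norm v"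
        by (intro add_mono F(3) norm_apply_diag_finite E_complex_linear x') (use F(1) in simp)
      also have "(\<Sum>y\<in>F \<inter> G. norm (blinfun_apply (E {x}) (delta y))) \<le> (\<Sum>y\<in>G. \<epsilon> / (card G + 1))"
        using G by (intro order_trans[OF sum_mono sum_mono2] le) (auto simp: D_def \<epsilon> less_imp_le)
      also have "\<dots> \<le> \<epsilon>" using \<epsilon> by (simp add: field_simps)
      finally show ?thesis by (simp add: \<epsilon>_def mult_right_mono mult.commute)
    qed
    have far: "e y z > real n" if "m < n" "y \<in> snd (h m)" "z \<in> F - G" for m y z
      using that F(2) unfolding G_def by force
    have "fst (h m) \<noteq> x" if "m < n" for m
    proof
      assume "fst (h m) = x"
      then have "norm (blinfun_apply (E {x}) (delta (y m))) \<in> D"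
        using that by (auto simp: D_def)
      then show False using lt[of "y m"] y[OF that] Min_le[OF D(1)] by fastforce
    qed
    then show ?thesis
      by (intro exI[of _ "(x, F - G)"])
        (use x F(1,2) diag far le in \<open>auto simp: V_def R_def D_def\<close>)
  qed
  have "\<exists>h. \<forall>n. V n (h n) \<and> (\<forall>m<n. R n (h m) (h n))"
  proof (rule dependent_wellorder_choice)
    show "\<exists>q. V n q \<and> (\<forall>m<n. R n (h m) q)" if "\<And>m. m < n \<Longrightarrow> V m (h m) \<and> (\<forall>k<m. R m (h k) (h m))" for n h
      using step that by blast
  qed auto
  then obtain h where h: "\<And>n. V n (h n)" "\<And>m n. m < n \<Longrightarrow> R n (h m) (h n)" by blast
  show ?thesis
  proof (rule that[of "fst \<circ> h" "snd \<circ> h"])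
    show "inj (fst \<circ> h)"
    proof (rule injI)
      fix m n assume "(fst \<circ> h) m = (fst \<circ> h) n"
      then show "m = n" using h(2)[of m n] h(2)[of n m] by (cases m n rule: linorder_cases) (auto simp: R_def)
    qed
  qed (use h in \<open>auto simp: V_def R_def\<close>)
qed

text \<open>If this fails, the points \<open>s n\<close> of \<open>ex_spread_out_sequence\<close> give a ghost projection \<open>P\<close> over a sparse
  space \<open>Z\<close> that is not compact. The bound
  \<open>\<parallel>E {s n} \<delta>\<^sub>y\<parallel> \<le> 4\<^sup>-\<^sup>n\<close> for all \<open>y\<close> makes \<open>Q = E (s ` A)\<close> a ghost, the spread out supports make
  \<open>Z\<close> sparse, and \<open>P\<close> inherits the ghost property because its columns are \<open>diag Z S\<close> applied to those
  of \<open>Q\<close>.\<close>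

lemma uniform_lower_bound:
  assumes ghosts: "\<forall>Z\<subseteq>Y. sparse_space Z e \<longrightarrow> only_compact_ghost_projections Z e"
  obtains \<delta> where "\<delta> > 0" "\<And>x. x \<in> X \<Longrightarrow> \<exists>y\<in>Y. \<delta> \<le> norm (blinfun_apply (E {x}) (delta y))"
proof -
  have "\<exists>\<delta>>0. \<forall>x\<in>X. \<exists>y\<in>Y. \<delta> \<le> norm (blinfun_apply (E {x}) (delta y))"
  proof (rule ccontr)
    assume "\<not> ?thesis"
    then have low: "\<exists>x\<in>X. \<forall>y\<in>Y. norm (blinfun_apply (E {x}) (delta y)) < \<delta>" if "\<delta> > 0" for \<delta>
      using that by (meson not_le)
    obtain s :: "nat \<Rightarrow> 'a" and F :: "nat \<Rightarrow> 'b set" where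
      s: "inj s" "range s \<subseteq> X" and F: "\<And>n. finite (F n)" "\<And>n. F n \<subseteq> Y"
      and small: "\<And>n y. norm (blinfun_apply (E {s n}) (delta y)) \<le> (1 / 4) ^ n"
      and tail: "\<And>n v. norm (blinfun_apply (E {s n}) (diag (- F n) v)) \<le> 1 / 8 * (1 / 2) ^ n * norm v"
      and far: "\<And>m n y z. m < n \<Longrightarrow> y \<in> F m \<Longrightarrow> z \<in> F n \<Longrightarrow> e y z > real n"
      by (rule ex_spread_out_sequence) (rule low, assumption, rule that)
    note sX = order_trans[OF image_mono[OF subset_UNIV] s(2)]
    have sX1: "s n \<in> X" for n using s(2) by blast
    obtain A where A: "infinite A" and sub: "countably_subadditive s A"
      by (rule ex_countably_subadditive_subsequence[OF s])
    define Q where "Q = E (s ` A)"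
    define Z where "Z = (\<Union>n. F n)"
    have ZY: "Z \<subseteq> Y" using F(2) by (auto simp: Z_def)
    have Q: "Q \<in> uniform_Roe Y e" "projection_op Q"
      unfolding Q_def by (intro E_in E_projection sX)+
    note Qlin = uniform_Roe_complex_linear[OF Q(1)]
    have geo: "(\<lambda>n. C * (1 / 2) ^ n :: real) sums (2 * C)" for C
      using sums_mult[OF geometric_sums[of "1 / 2 :: real"], of C] by (simp add: mult.commute)
    have QZ: "norm (blinfun_apply Q (diag (- Z) v)) \<le> norm v / 4" for v
    proof -
      have "norm (blinfun_apply (E {s n}) (diag (- Z) v)) \<le> 1 / 8 * norm v * (1 / 2) ^ n" for n
      proof -
        have "diag (- Z) v = diag (- F n) (diag (- Z) v)"
          by (rule ell2_eqI) (auto simp: ell2_apply_diag Z_def)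
        then have "norm (blinfun_apply (E {s n}) (diag (- Z) v)) \<le> 1 / 8 * (1 / 2) ^ n * norm (diag (- Z) v)"
          using tail[of n "diag (- Z) v"] by simp
        also have "\<dots> \<le> 1 / 8 * (1 / 2) ^ n * norm v" by (intro mult_left_mono norm_shift_le) simp
        finally show ?thesis by (simp add: mult_ac)
      qed
      then have "norm (blinfun_apply Q (diag (- Z) v)) \<le> 2 * (1 / 8 * norm v)"
        unfolding Q_def by (intro countably_subadditiveD[OF sub _ geo]) simp_all
      then show ?thesis by simp
    qed
    obtain S where S: "S \<in> uniform_Roe Y e" "adj S = S" "S o\<^sub>L Q = S"
      "\<And>v. blinfun_apply S (diag Z (blinfun_apply Q v)) = blinfun_apply Q v"
      using ex_corner_inverse[OF metric_Y Q ZY QZ] by blast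
    have SQ: "blinfun_apply S (blinfun_apply Q v) = blinfun_apply S v" for v
      using S(3) by (metis blinfun_apply_blinfun_compose)
    note Slin = uniform_Roe_complex_linear[OF S(1)]
    have QS: "blinfun_apply Q (blinfun_apply S v) = blinfun_apply S v" for v
      by (rule cinner_right_eqI)
        (simp add: projection_op_cinner[OF Qlin Q(2), symmetric] cinner_adj[OF Slin, unfolded S(2), symmetric] SQ)
    define P where "P = diag Z o\<^sub>L S o\<^sub>L diag Z"
    have P_apply: "blinfun_apply P v = diag Z (blinfun_apply S (diag Z v))" for v
      by (simp add: P_def)
    have P_in: "P \<in> uniform_Roe Z e"
      unfolding P_def by (rule compression_in_uniform_Roe[OF ZY S(1)])
    have SZS: "blinfun_apply S (diag Z (blinfun_apply S v)) = blinfun_apply S v" for v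
      using S(4)[of "blinfun_apply S v"] by (simp add: QS)
    have "P o\<^sub>L P = P"
      by (rule blinfun_eqI) (simp add: P_apply diag_eqs SZS)
    moreover have "adj P = P"
      by (rule adj_eqI) (simp add: P_apply cinner_diag cinner_adj[OF Slin, unfolded S(2)])
    ultimately have P_proj: "projection_op P" by (simp add: projection_op_def)
    have Q_small: "\<exists>B. finite B \<and> B \<subseteq> Y \<and> (\<forall>y. y \<notin> B \<longrightarrow> norm (blinfun_apply Q (delta y)) \<le> \<epsilon>)"
      if "\<epsilon> > 0" for \<epsilon> :: real
    proof -
      obtain N :: nat where N: "(1 / 2) ^ N < \<epsilon> / 2"
        using real_arch_pow_inv[of "\<epsilon> / 2" "1 / 2"] \<open>\<epsilon> > 0\<close> by auto
      have "\<forall>n. \<exists>B. finite B \<and> B \<subseteq> Y \<and>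
          (\<forall>y. y \<notin> B \<longrightarrow> norm (blinfun_apply (E {s n}) (delta y)) \<le> \<epsilon> / 2 * (1 / 2) ^ n)"
        using E_singleton_delta_small[OF sX1] that
        by (metis half_gt_zero mult_pos_pos zero_less_power zero_less_divide_1_iff zero_less_numeral)
      then obtain B where B: "\<And>n. finite (B n)" "\<And>n. B n \<subseteq> Y"
        "\<And>n y. y \<notin> B n \<Longrightarrow> norm (blinfun_apply (E {s n}) (delta y)) \<le> \<epsilon> / 2 * (1 / 2) ^ n" by metis
      have "norm (blinfun_apply Q (delta y)) \<le> \<epsilon>" if y: "y \<notin> (\<Union>n<N. B n)" for y
      proof -
        have "norm (blinfun_apply (E {s n}) (delta y)) \<le> \<epsilon> / 2 * (1 / 2) ^ n" for n
        \<comment> \<open>From \<open>N\<close> on, half of the decay \<open>4\<^sup>-\<^sup>n = 2\<^sup>-\<^sup>n 2\<^sup>-\<^sup>n\<close> already beats \<open>\<epsilon> / 2\<close>, so only finitely many compact \<open>E {s n}\<close> matter.\<close>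
        proof (cases "n < N")
          case True
          then show ?thesis using B(3) y by blast
        next
          case False
          have "norm (blinfun_apply (E {s n}) (delta y)) \<le> (1 / 2) ^ n * (1 / 2) ^ n"
            using small[of n y] by (simp flip: power_mult_distrib)
          also have "\<dots> \<le> \<epsilon> / 2 * (1 / 2) ^ n"
          proof (rule mult_right_mono)
            have "(1 / 2) ^ n \<le> ((1 / 2) ^ N :: real)" using False by (intro power_decreasing) auto
            then show "(1 / 2) ^ n \<le> \<epsilon> / 2" using N by linarith
          qed simp
          finally show ?thesis .
        qed
        then have "norm (blinfun_apply Q (delta y)) \<le> 2 * (\<epsilon> / 2)"
          unfolding Q_def using \<open>\<epsilon> > 0\<close> by (intro countably_subadditiveD[OF sub _ geo]) simp_all
        then show ?thesis by simp
      qed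
      then show ?thesis using B(1,2) by (intro exI[of _ "\<Union>n<N. B n"]) auto
    qed
    have "ghost Z P"
      unfolding ghost_def
    proof (intro allI impI)
      fix \<epsilon> :: real assume "\<epsilon> > 0"
      define \<eta> where "\<eta> = \<epsilon> / (2 * (norm S + 1))"
      have nS: "norm S + 1 > 0" by (simp add: add_nonneg_pos)
      then have "\<eta> > 0" using \<open>\<epsilon> > 0\<close> by (simp add: \<eta>_def)
      then obtain B where B: "finite B" "\<And>y. y \<notin> B \<Longrightarrow> norm (blinfun_apply Q (delta y)) \<le> \<eta>"
        using Q_small by blast
      have "cmod (cinner (P (delta x)) (delta y)) < \<epsilon>" if "x \<in> Z - B" for x y
      proof -
        have "cmod (cinner (P (delta x)) (delta y)) \<le> norm (P (delta x))"
          by (simp add: cmod_ell2_apply_le)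
        also have "\<dots> \<le> norm (blinfun_apply S (blinfun_apply Q (delta x)))"
          using that norm_shift_le by (simp add: P_apply shift_delta SQ)
        also have "\<dots> \<le> norm S * norm (blinfun_apply Q (delta x))" by (rule norm_blinfun)
        also have "\<dots> \<le> norm S * \<eta>" by (intro mult_left_mono B(2)) (use that in auto)
        also have "\<dots> \<le> (norm S + 1) * \<eta>" using \<open>\<eta> > 0\<close> by (intro mult_right_mono) auto
        also have "\<dots> = \<epsilon> / 2" unfolding \<eta>_def using nS by (simp add: field_simps)
        finally show ?thesis using \<open>\<epsilon> > 0\<close> by linarith
      qed
      then show "\<exists>A. finite A \<and> A \<subseteq> Z \<and>
          (\<forall>x\<in>Z - A. \<forall>y\<in>Z - A. cmod (cinner (P (delta x)) (delta y)) < \<epsilon>)"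
        using B(1) by (intro exI[of _ "B \<inter> Z"]) auto
    qed
    moreover have "sparse_space Z e"
      unfolding sparse_space_def
    proof (intro exI[of _ F] conjI allI)
      have distinct: "F m \<inter> F n = {}" if "m < n" for m n
      proof -
        have False if "y \<in> F m" "y \<in> F n" for y
        proof -
          interpret Metric_space Y e by (rule metric_Y)
          have "e y y > real n" using far[OF \<open>m < n\<close>] that by blast
          moreover have "e y y = 0" using zero[of y y] F(2)[of m] that(1) by blast
          ultimately show False by simp
        qed
        then show ?thesis by blast
      qed
      show "disjoint_family F"
        unfolding disjoint_family_on_def
      proof (intro ballI impI)
        fix m n :: nat assume "m \<noteq> n"
        then show "F m \<inter> F n = {}" using distinct[of m n] distinct[of n m] by (cases "m < n") auto
      qed
      fix R :: real
      obtain K :: nat where K: "real K > R" using reals_Archimedean2 by blast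
      have lt: "e y z > real K" if "n \<noteq> m" "n + m \<ge> 2 * K" "y \<in> F n" "z \<in> F m" for n m y z
      proof (cases "n < m")
        case True
        then show ?thesis using far[OF True that(3,4)] that(2) by linarith
      next
        case False
        then have "m < n" using that by simp
        interpret Metric_space Y e by (rule metric_Y)
        have "e y z = e z y" by (rule commute)
        then show ?thesis using far[OF \<open>m < n\<close> that(4,3)] that(2) \<open>m < n\<close> by linarith
      qed
      have "set_distance e (F n) (F m) > ereal R" if "n \<noteq> m" "n + m \<ge> 2 * K" for n m
      proof -
        have "ereal (real K) \<le> set_distance e (F n) (F m)"
          unfolding set_distance_def
          by (intro INF_greatest) (use lt[OF that] in \<open>auto intro: less_imp_le\<close>)
        then show ?thesis using K by (meson ereal_less_le less_ereal.simps(1) order_less_le_trans)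
      qed
      then show "\<exists>N. \<forall>n m. n \<noteq> m \<and> n + m \<ge> N \<longrightarrow> set_distance e (F n) (F m) > ereal R" by blast
    qed (auto simp: F(1) Z_def)
    ultimately have "compact_op P"
      using ghosts ZY P_in P_proj unfolding only_compact_ghost_projections_def by blast
    moreover have "\<not> compact_op P"
    proof -
      \<comment> \<open>The vectors \<open>diag Z (\<xi> n)\<close>, with \<open>\<xi> n\<close> a unit vector in the range of \<open>E {s n}\<close>, are fixed by \<open>P\<close> and separated.\<close>
      have "\<exists>v. norm v = 1 \<and> blinfun_apply (E {s n}) v = v" for n
      proof -
        obtain y where "blinfun_apply (E {s n}) (delta y) \<noteq> 0"
          using E_singleton_nonzero[OF sX1[of n]] by blast
        then show ?thesis
          using E_E[of "{s n}" "{s n}"] sX1[of n]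
          by (intro exI[of _ "sgn (blinfun_apply (E {s n}) (delta y))"])
            (simp add: norm_sgn sgn_div_norm blinfun.scaleR_right)
      qed
      then obtain \<xi> where \<xi>: "\<And>n. norm (\<xi> n) = 1" "\<And>n. blinfun_apply (E {s n}) (\<xi> n) = \<xi> n" by metis
      have Q\<xi>: "blinfun_apply Q (\<xi> n) = \<xi> n" if "n \<in> A" for n
      proof -
        have "s ` A \<inter> {s n} = {s n}" using that by blast
        then show ?thesis
          using E_E[OF sX, of "{s n}" A "\<xi> n"] sX1[of n] by (simp add: Q_def \<xi>(2))
      qed
      show ?thesis
      proof (rule not_compact_if_separated_fixed_vectors[OF A, where u = "\<lambda>n. diag Z (\<xi> n)" and c = "1 / 2"])
        show "norm (diag Z (\<xi> n)) \<le> 1 \<and> blinfun_apply P (diag Z (\<xi> n)) = diag Z (\<xi> n)" if "n \<in> A" for n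
          using norm_shift_le[of Z id "\<xi> n"] S(4)[of "\<xi> n"]
          by (simp add: \<xi>(1) P_apply diag_eqs Q\<xi>[OF that])
        fix n m assume nm: "n \<in> A" "m \<in> A" "n \<noteq> m"
        define w where "w = \<xi> n - \<xi> m"
        have "{s n} \<inter> {s m} = {}" using nm(3) s(1) by (auto dest: injD)
        then have "inner (\<xi> n) (\<xi> m) = 0"
          using E_orthogonal[of "{s n}" "{s m}" "\<xi> n" "\<xi> m"] sX1 by (simp add: \<xi>(2))
        then have w2: "(norm w)\<^sup>2 = 2"
          using \<xi>(1)[of n] \<xi>(1)[of m]
          by (simp add: w_def power2_norm_eq_inner inner_diff_left inner_diff_right inner_commute norm_eq_1)
        have Qw: "blinfun_apply Q w = w" using nm Q\<xi> by (simp add: w_def blinfun.diff_right)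
        have "(norm (diag (- Z) w))\<^sup>2 = inner w (diag (- Z) w)"
          using inner_diag[of "- Z" w "diag (- Z) w"] by (simp add: power2_norm_eq_inner diag_eqs)
        also have "\<dots> = inner w (blinfun_apply Q (diag (- Z) w))"
          using projection_op_inner[OF Qlin Q(2), of w "diag (- Z) w"] by (simp add: Qw)
        also have "\<dots> \<le> norm w * (norm w / 4)"
          by (rule order_trans[OF norm_cauchy_schwarz mult_left_mono[OF QZ]]) simp
        also have "\<dots> = (norm w / 2)\<^sup>2" by (simp add: power2_eq_square)
        finally have "norm (diag (- Z) w) \<le> norm w / 2" by (rule power2_le_imp_le) simp
        moreover have "norm w \<le> norm (diag Z w) + norm (diag (- Z) w)"
          using norm_triangle_ineq[of "diag Z w" "diag (- Z) w"] diag_plus_diag_Compl[of w Z] by simp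
        moreover have "norm w \<ge> 1" by (rule power2_le_imp_le) (simp_all add: w2)
        ultimately have "1 / 2 \<le> norm (diag Z w)" by linarith
        then show "1 / 2 \<le> norm (diag Z (\<xi> n) - diag Z (\<xi> m))" by (simp add: w_def blinfun.diff_right)
      qed simp
    qed
    ultimately show False by blast
  qed
  then show ?thesis using that by blast
qed

end

section \<open>Matrix units and colourings\<close>

text \<open>The matrix unit \<open>e\<^sub>y\<^sub>x\<close>, which maps \<open>\<delta>\<^sub>x\<close> to \<open>\<delta>\<^sub>y\<close>.\<close>

definition unit_op :: "'a \<Rightarrow> 'a \<Rightarrow> 'a ell2 \<Rightarrow>\<^sub>L 'a ell2" where
  "unit_op y x = shift {x} (\<lambda>_. y)"

lemma unit_op_apply: "unit_op y x v = scaleC (ell2_apply v x) (delta y)"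
proof (rule ell2_eqI)
  show "ell2_apply (unit_op y x v) z = ell2_apply (scaleC (ell2_apply v x) (delta y)) z" for z
    unfolding unit_op_def
    using ell2_apply_shift_image[of "\<lambda>_. y" "{x}" x v] ell2_apply_shift_outside[of z "\<lambda>_. y" "{x}" v]
    by (cases "z = y") (auto simp: ell2_apply_delta)
qed

lemma unit_op_compose: "unit_op z y o\<^sub>L unit_op y x = unit_op z x"
  by (rule blinfun_eqI) (simp add: unit_op_apply ell2_apply_delta)

lemma unit_op_diag: "unit_op x x = diag {x}"
  by (rule blinfun_eqI) (simp add: unit_op_apply diag_finite)

lemma cinner_delta_left: "cinner (delta y) w = cnj (ell2_apply w y)"
  using cinner_cnj[of w "delta y"] by simp

lemma adj_unit_op: "adj (unit_op y x) = unit_op x y"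
proof (rule adj_eqI)
  fix v w :: "'a ell2"
  have "cinner v (unit_op x y w) = cnj (cinner (scaleC (ell2_apply w y) (delta x)) v)"
    by (simp add: unit_op_apply cinner_cnj)
  then show "cinner (unit_op y x v) w = cinner v (unit_op x y w)"
    by (simp add: unit_op_apply cinner_scaleC_left cinner_delta_left)
qed

lemma ex_partition_of_finite_colouring:
  assumes "finite C" "\<And>x. x \<in> X \<Longrightarrow> col x \<in> C"
  obtains k :: nat and P :: "nat \<Rightarrow> 'a set" where "k \<ge> 1" "(\<Union>n\<in>{1..k}. P n) = X"
    "disjoint_family_on P {1..k}" "\<And>n x y. x \<in> P n \<Longrightarrow> y \<in> P n \<Longrightarrow> col x = col y"
proof -
  obtain c :: "'b \<Rightarrow> nat" and n where c: "c ` C = {i. i < n}" "inj_on c C"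
    using finite_imp_inj_to_nat_seg[OF assms(1)] by blast
  define P where "P m = {x \<in> X. Suc (c (col x)) = m}" for m
  show ?thesis
  proof (rule that[of "Suc n" P])
    show "(\<Union>m\<in>{1..Suc n}. P m) = X"
    proof -
      have "Suc (c (col x)) \<in> {1..Suc n}" if "x \<in> X" for x
      proof -
        have "c (col x) \<in> {i. i < n}" using assms(2)[OF that] c(1) by blast
        then show ?thesis by simp
      qed
      then show ?thesis unfolding P_def by blast
    qed
    show "disjoint_family_on P {1..Suc n}" by (auto simp: disjoint_family_on_def P_def)
    show "col x = col y" if "x \<in> P m" "y \<in> P m" for m x y
      using that assms(2) c(2) by (auto simp: P_def dest: inj_onD)
  qed simp
qed

text \<open>For splitting \<open>X\<close> into pieces on which \<open>f\<close> is injective: \<open>\<iota>\<close> numbers the points of each fibre.\<close>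

lemma ex_fibre_index:
  assumes "\<And>y. finite {x \<in> X. f x = y} \<and> card {x \<in> X. f x = y} \<le> K"
  obtains \<iota> :: "'a \<Rightarrow> nat" where "\<And>x. x \<in> X \<Longrightarrow> \<iota> x < K"
    "\<And>x x'. x \<in> X \<Longrightarrow> x' \<in> X \<Longrightarrow> f x = f x' \<Longrightarrow> \<iota> x = \<iota> x' \<Longrightarrow> x = x'"
proof -
  have "\<exists>h :: 'a \<Rightarrow> nat. inj_on h {x \<in> X. f x = y} \<and> h ` {x \<in> X. f x = y} \<subseteq> {..<K}" for y
  proof -
    obtain h :: "'a \<Rightarrow> nat" where h: "bij_betw h {x \<in> X. f x = y} {0..<card {x \<in> X. f x = y}}"
      using ex_bij_betw_finite_nat assms by blast
    then show ?thesis using assms[of y] by (intro exI[of _ h]) (auto simp: bij_betw_def)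
  qed
  then obtain h :: "'b \<Rightarrow> 'a \<Rightarrow> nat" where
    h: "\<And>y. inj_on (h y) {x \<in> X. f x = y}" "\<And>y. h y ` {x \<in> X. f x = y} \<subseteq> {..<K}" by metis
  show ?thesis
  proof (rule that[of "\<lambda>x. h (f x) x"])
    show "h (f x) x < K" if "x \<in> X" for x using h(2)[of "f x"] that by auto
    show "x = x'" if "x \<in> X" "x' \<in> X" "f x = f x'" "h (f x) x = h (f x') x'" for x x'
      using inj_onD[OF h(1)[of "f x"], of x x'] that by simp
  qed
qed

section \<open>Large matrix entries force coarseness\<close>

context compact_Roe_embedding
begin

text \<open>For \<open>w = shift A g\<close>, applying \<open>\<Phi>\<close> to \<open>w\<^sup>* w = diag A\<close> gives \<open>\<parallel>\<Phi> w v\<parallel>\<^sup>2 = \<langle>E A v, v\<rangle>\<close>.\<close>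

lemma Phi_shift_norm:
  assumes "A \<subseteq> X" "g ` A \<subseteq> X" "inj_on g A" and r: "\<And>x. x \<in> A \<Longrightarrow> d x (g x) \<le> r"
  shows "shift A g \<in> uniform_Roe X d"
    and "norm (blinfun_apply (\<Phi> (shift A g)) v) = norm (blinfun_apply (E A) v)"
proof -
  interpret Metric_space X d by (rule metric_X)
  show W: "shift A g \<in> uniform_Roe X d" by (rule shift_in_uniform_Roe[OF assms(1-3)]) (rule r)
  have W': "adj (shift A g) \<in> uniform_Roe X d"
    unfolding adj_shift[OF assms(3)]
  proof (rule shift_in_uniform_Roe)
    show "d y (inv_into A g y) \<le> r" if "y \<in> g ` A" for y
      using that r assms(3) commute by auto
  qed (use assms in \<open>auto simp: inj_on_inv_into\<close>)
  have "adj (shift A g) o\<^sub>L shift A g = diag A"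
    unfolding adj_shift[OF assms(3)] by (rule blinfun_eqI) (simp add: shift_inv_shift[OF assms(3)])
  then have "cinner (blinfun_apply (\<Phi> (shift A g)) v) (blinfun_apply (\<Phi> (shift A g)) v)
      = cinner v (blinfun_apply (E A) v)"
    by (simp add: cinner_Phi[OF W] Phi_compose[OF W' W, symmetric] E_def)
  also have "\<dots> = cinner (blinfun_apply (E A) v) (blinfun_apply (E A) v)"
    using projection_op_cinner[OF E_complex_linear[OF assms(1)] E_projection[OF assms(1)]]
    by (simp add: E_E assms(1))
  finally show "norm (blinfun_apply (\<Phi> (shift A g)) v) = norm (blinfun_apply (E A) v)"
    by (simp add: norm_eq_sqrt_inner inner_eq_Re_cinner)
qed

lemma unit_op_in:
  assumes "x \<in> X" "y \<in> X"
  shows "unit_op y x \<in> uniform_Roe X d"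
    and "norm (blinfun_apply (\<Phi> (unit_op y x)) v) = norm (blinfun_apply (E {x}) v)"
  unfolding unit_op_def using assms by (intro Phi_shift_norm[of _ _ "d x y"]; simp)+

lemma E_finite_norm_square:
  assumes "finite B" "B \<subseteq> X"
  shows "(norm (blinfun_apply (E B) v))\<^sup>2 = (\<Sum>x\<in>B. (norm (blinfun_apply (E {x}) v))\<^sup>2)"
  using assms
proof (induction B rule: finite_induct)
  case (insert x B)
  then show ?case using E_norm_square_Un[of "{x}" B v] by simp
qed (simp add: E_empty)

text \<open>Bessel's inequality for the orthogonal projections \<open>E {x}\<close>.\<close>

lemma large_singletons_bounded:
  assumes "\<delta> > 0"
  shows "finite {x \<in> X. \<delta> \<le> norm (blinfun_apply (E {x}) (delta y))}" (is "finite ?S")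
    and "card {x \<in> X. \<delta> \<le> norm (blinfun_apply (E {x}) (delta y))} \<le> nat \<lfloor>1 / \<delta>\<^sup>2\<rfloor>"
proof -
  have "card T \<le> nat \<lfloor>1 / \<delta>\<^sup>2\<rfloor>" if T: "T \<subseteq> ?S" "finite T" for T
  proof -
    have TX: "T \<subseteq> X" using T(1) by blast
    have "real (card T) * \<delta>\<^sup>2 = (\<Sum>x\<in>T. \<delta>\<^sup>2)" by simp
    also have "\<dots> \<le> (\<Sum>x\<in>T. (norm (blinfun_apply (E {x}) (delta y)))\<^sup>2)"
      using T(1) assms by (intro sum_mono power_mono) auto
    also have "\<dots> = (norm (blinfun_apply (E T) (delta y)))\<^sup>2"
      by (rule E_finite_norm_square[OF T(2) TX, symmetric])
    also have "\<dots> \<le> 1" using E_norm_le[OF TX, of "delta y"] by (simp add: power_le_one)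
    finally have "real (card T) \<le> 1 / \<delta>\<^sup>2" using assms by (simp add: field_simps)
    then show ?thesis by linarith
  qed
  then show "finite ?S" "card ?S \<le> nat \<lfloor>1 / \<delta>\<^sup>2\<rfloor>"
    using finite_if_finite_subsets_card_bdd[of ?S] by blast+
qed

text \<open>Each requirement on a new pair \<open>(x, x')\<close> excludes only finitely many \<open>x\<close> and \<open>x'\<close>: for the
  smallness of \<open>\<parallel>E {s m} \<delta>\<^bsub>f x\<^esub>\<parallel>\<close> by compactness and injectivity of \<open>f\<close>, for that of \<open>\<parallel>E {x} \<delta>\<^bsub>f (s m)\<^esub>\<parallel>\<close> by
  Bessel's inequality. The pairs at distance at most \<open>r\<close> that meet a finite set form a finite set, on which
  \<open>e (f x) (f x')\<close> is bounded, so a pair with a larger value avoids it.\<close>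

lemma ex_separating_pairs:
  assumes P: "P \<subseteq> X" and f: "f \<in> P \<rightarrow> Y" "inj_on f P" and "\<eta> > 0"
    and far: "\<And>M. \<exists>x\<in>P. \<exists>x'\<in>P. d x x' \<le> r \<and> e (f x) (f x') > M"
  obtains s t :: "nat \<Rightarrow> 'a" where "inj s" "inj t" "range s \<subseteq> P" "range t \<subseteq> P"
    "\<And>n. d (s n) (t n) \<le> r" "\<And>n. e (f (s n)) (f (t n)) > real n"
    "\<And>m n. m \<noteq> n \<Longrightarrow> norm (blinfun_apply (E {s m}) (delta (f (s n)))) \<le> \<eta> * (1 / 2) ^ m"
proof -
  define V where "V n p \<longleftrightarrow> fst p \<in> P \<and> snd p \<in> P \<and> d (fst p) (snd p) \<le> r \<and>
    e (f (fst p)) (f (snd p)) > real n" for n :: nat and p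
  define R where "R n p q \<longleftrightarrow> fst p \<noteq> fst q \<and> snd p \<noteq> snd q \<and>
    norm (blinfun_apply (E {fst p}) (delta (f (fst q)))) \<le> \<eta> * (1 / 2) ^ n \<and>
    norm (blinfun_apply (E {fst q}) (delta (f (fst p)))) \<le> \<eta> * (1 / 2) ^ n"
    for n :: nat and p q :: "'a \<times> 'a"
  have step: "\<exists>q. V n q \<and> (\<forall>m<n. R n (h m) q)" if h: "\<And>m. m < n \<Longrightarrow> V m (h m)" for n h
  proof -
    define \<epsilon> where "\<epsilon> = \<eta> * (1 / 2) ^ n"
    have \<epsilon>: "\<epsilon> > 0" using \<open>\<eta> > 0\<close> by (simp add: \<epsilon>_def)
    define B1 where "B1 = (\<Union>m<n. {x \<in> P. \<not> norm (blinfun_apply (E {fst (h m)}) (delta (f x))) \<le> \<epsilon>})"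
    define B2 where "B2 = (\<Union>m<n. {x \<in> P. \<not> norm (blinfun_apply (E {x}) (delta (f (fst (h m))))) \<le> \<epsilon>})"
    define B where "B = B1 \<union> B2 \<union> (\<lambda>m. fst (h m)) ` {..<n} \<union> (\<lambda>m. snd (h m)) ` {..<n}"
    have "finite {x \<in> P. \<not> norm (blinfun_apply (E {fst (h m)}) (delta (f x))) \<le> \<epsilon>}" if "m < n" for m
    proof -
      have hm: "fst (h m) \<in> X" using h[OF that] P by (auto simp: V_def)
      obtain F where F: "finite F" "F \<subseteq> Y" "\<And>y. y \<notin> F \<Longrightarrow> norm (blinfun_apply (E {fst (h m)}) (delta y)) \<le> \<epsilon>"
        using E_singleton_delta_small[OF hm \<epsilon>] by blast
      show ?thesis
        by (rule finite_subset[OF _ finite_vimage_IntI[OF F(1) f(2)]]) (use F(3) in auto)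
    qed
    then have "finite B1" unfolding B1_def by blast
    moreover have "finite {x \<in> P. \<not> norm (blinfun_apply (E {x}) (delta (f (fst (h m))))) \<le> \<epsilon>}" for m
      by (rule finite_subset[OF _ large_singletons_bounded(1)[OF \<epsilon>, of "f (fst (h m))"]]) (use P in auto)
    then have "finite B2" unfolding B2_def by blast
    ultimately have B: "finite B" "B \<subseteq> X"
      using h P by (auto simp: B_def B1_def B2_def V_def)
    \<comment> \<open>A pair at distance at most \<open>r\<close> with one point in \<open>B\<close> has both points in \<open>N\<close>.\<close>
    define N where "N = B \<union> {z \<in> X. \<exists>y\<in>B. d y z \<le> r}"
    have "finite N" unfolding N_def using B finite_neighbourhood[OF metric_X ulf_X B] by blast
    then have "finite ((\<lambda>(x, y). e (f x) (f y)) ` (N \<times> N))" by blast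
    then obtain M where M: "\<And>x y. x \<in> N \<Longrightarrow> y \<in> N \<Longrightarrow> e (f x) (f y) \<le> M"
      using bdd_above_finite unfolding bdd_above_def by fastforce
    obtain x x' where x: "x \<in> P" "x' \<in> P" "d x x' \<le> r" "e (f x) (f x') > max M (real n)"
      using far by blast
    interpret Metric_space X d by (rule metric_X)
    have "\<not> (x \<in> N \<and> x' \<in> N)" using M[of x x'] x(4) by auto
    then have "x \<notin> B" "x' \<notin> B"
      using x P commute[of x x'] by (auto simp: N_def)
    then have "V n (x, x')" "\<forall>m<n. R n (h m) (x, x')"
      using x by (auto simp: V_def R_def B_def B1_def B2_def \<epsilon>_def)
    then show ?thesis by blast
  qed
  have "\<exists>h. \<forall>n. V n (h n) \<and> (\<forall>m<n. R n (h m) (h n))"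
  proof (rule dependent_wellorder_choice)
    show "\<exists>q. V n q \<and> (\<forall>m<n. R n (h m) q)" if "\<And>m. m < n \<Longrightarrow> V m (h m) \<and> (\<forall>k<m. R m (h k) (h m))" for n h
      using step that by blast
  qed auto
  then obtain h where h: "\<And>n. V n (h n)" "\<And>m n. m < n \<Longrightarrow> R n (h m) (h n)" by blast
  show ?thesis
  proof (rule that[of "\<lambda>n. fst (h n)" "\<lambda>n. snd (h n)"])
    show "inj (\<lambda>n. fst (h n))"
    proof (rule injI)
      fix m n assume "fst (h m) = fst (h n)"
      then show "m = n" using h(2)[of m n] h(2)[of n m] by (cases m n rule: linorder_cases) (auto simp: R_def)
    qed
    show "inj (\<lambda>n. snd (h n))"
    proof (rule injI)
      fix m n assume "snd (h m) = snd (h n)"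
      then show "m = n" using h(2)[of m n] h(2)[of n m] by (cases m n rule: linorder_cases) (auto simp: R_def)
    qed
    show "norm (blinfun_apply (E {fst (h m)}) (delta (f (fst (h n))))) \<le> \<eta> * (1 / 2) ^ m" if "m \<noteq> n" for m n
    proof (cases "m < n")
      case True
      have "\<eta> * (1 / 2) ^ n \<le> \<eta> * (1 / 2) ^ m"
        using True \<open>\<eta> > 0\<close> by (intro mult_left_mono power_decreasing) auto
      then show ?thesis using h(2)[OF True] by (auto simp: R_def)
    next
      case False
      then show ?thesis using h(2)[of n m] that by (auto simp: R_def)
    qed
  qed (use h(1) in \<open>auto simp: V_def\<close>)
qed

text \<open>Gliding hump: let \<open>w\<close> be the partial translation \<open>s n \<mapsto> t n\<close>, \<open>n \<in> A\<close>, along separating pairs. It has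
  propagation at most \<open>r\<close>. In the entry of \<open>\<Phi>(w)\<close> at \<open>(f (s n), f (t n))\<close> the summand of \<open>e\<^bsub>t n, s n\<^esub>\<close> is at
  least \<open>c\<close> and the remaining ones contribute at most \<open>c/4\<close>, by the choice of the pairs and countable
  subadditivity. These entries sit at distance \<open>> n\<close>, so \<open>\<Phi>(w)\<close> is not a norm limit of operators of
  finite propagation.\<close>

lemma coarse_if_large_entries:
  assumes P: "P \<subseteq> X" and f: "f \<in> P \<rightarrow> Y" "inj_on f P" and "c > 0"
    and large: "\<And>x x'. x \<in> P \<Longrightarrow> x' \<in> P \<Longrightarrow>
      c \<le> cmod (cinner (blinfun_apply (\<Phi> (unit_op x' x)) (delta (f x))) (delta (f x')))"
  shows "coarse_map P d Y e f"
proof (rule ccontr)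
  assume "\<not> ?thesis"
  then have "\<not> (\<forall>r>0. bdd_above {e (f x) (f y) | x y. x \<in> P \<and> y \<in> P \<and> d x y \<le> r})"
    using f(1) by (simp add: coarse_map_def)
  then obtain r where r: "r > 0" "\<not> bdd_above {e (f x) (f y) | x y. x \<in> P \<and> y \<in> P \<and> d x y \<le> r}"
    by (simp only: not_all not_imp) (elim exE conjE)
  have far: "\<exists>x\<in>P. \<exists>x'\<in>P. d x x' \<le> r \<and> e (f x) (f x') > M" for M
  proof (rule ccontr)
    assume "\<not> ?thesis"
    then have "e (f x) (f y) \<le> M" if "x \<in> P" "y \<in> P" "d x y \<le> r" for x y
      using that not_le by blast
    then show False using r(2) unfolding bdd_above_def by blast
  qed
  have "c / 8 > 0" using \<open>c > 0\<close> by simp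
  obtain s t :: "nat \<Rightarrow> 'a" where st: "inj s" "inj t" "range s \<subseteq> P" "range t \<subseteq> P"
    "\<And>n. d (s n) (t n) \<le> r" "\<And>n. e (f (s n)) (f (t n)) > real n"
    "\<And>m n. m \<noteq> n \<Longrightarrow> norm (blinfun_apply (E {s m}) (delta (f (s n)))) \<le> c / 8 * (1 / 2) ^ m"
    using ex_separating_pairs[OF P f \<open>c / 8 > 0\<close> far] by metis
  have sP: "s n \<in> P" "t n \<in> P" for n using st(3,4) by blast+
  have sX: "s n \<in> X" "t n \<in> X" for n using sP P by blast+
  have rangeX: "range s \<subseteq> X" using st(3) P by blast
  obtain A where A: "infinite A" "countably_subadditive s A"
    by (rule ex_countably_subadditive_subsequence[OF st(1) rangeX])
  define g where "g x = t (inv s x)" for x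
  have g: "g (s n) = t n" for n by (simp add: g_def inv_f_f[OF st(1)])
  have shift: "shift (s ` B) g \<in> uniform_Roe X d"
    "norm (blinfun_apply (\<Phi> (shift (s ` B) g)) v) = norm (blinfun_apply (E (s ` B)) v)" for B v
  proof -
    have "inj_on g (s ` B)" using st(2) by (auto simp: inj_on_def g dest: injD)
    moreover have "s ` B \<subseteq> X" "g ` s ` B \<subseteq> X" using sX by (auto simp: g)
    moreover have "d x (g x) \<le> r" if "x \<in> s ` B" for x using that st(5) by (auto simp: g)
    ultimately show "shift (s ` B) g \<in> uniform_Roe X d"
      "norm (blinfun_apply (\<Phi> (shift (s ` B) g)) v) = norm (blinfun_apply (E (s ` B)) v)"
      by (intro Phi_shift_norm[of _ _ r]; blast)+
  qed
  obtain b where b: "b \<in> bounded_ops Y" "finite_propagation Y e b" "norm (\<Phi> (shift (s ` A) g) - b) < c / 4"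
    using uniform_Roe_approx[OF Phi_in[OF shift(1)[of A]], of "c / 4"] \<open>c > 0\<close> by auto
  obtain \<rho> where \<rho>: "\<And>x y. x \<in> Y \<Longrightarrow> y \<in> Y \<Longrightarrow> e x y > \<rho> \<Longrightarrow> ell2_apply (blinfun_apply b (delta x)) y = 0"
    using b(2) by (rule finite_propagationE) blast
  obtain n where n: "n \<in> A" "real n > \<rho>"
  proof -
    obtain n where "n \<in> A" "nat \<lceil>\<rho>\<rceil> < n" using A(1) unfolding infinite_nat_iff_unbounded by blast
    then show ?thesis using that[of n] by linarith
  qed
  let ?v = "delta (f (s n))" and ?w = "delta (f (t n))"
  have split: "shift (s ` A) g = unit_op (t n) (s n) + shift (s ` (A - {n})) g"
  proof (rule blinfun_eqI, rule ell2_eqI)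
    fix v y
    have inj: "inj_on g (s ` B)" for B using st(2) by (auto simp: inj_on_def g dest: injD)
    have ap: "ell2_apply (shift (s ` B) g v) (t m) = (if m \<in> B then ell2_apply v (s m) else 0)" for B m
    proof (cases "m \<in> B")
      case True
      then show ?thesis using ell2_apply_shift_image[OF inj, of "s m" B v] by (simp add: g)
    next
      case False
      then have "t m \<notin> g ` s ` B" using st(2) by (auto simp: g dest: injD)
      then show ?thesis using False by (simp add: ell2_apply_shift_outside)
    qed
    show "ell2_apply (shift (s ` A) g v) y
        = ell2_apply (blinfun_apply (unit_op (t n) (s n) + shift (s ` (A - {n})) g) v) y"
    proof (cases "y \<in> range t")
      case True
      then obtain m where "y = t m" by blast
      then show ?thesis
        using n(1) st(2) by (auto simp: blinfun.add_left unit_op_apply ell2_apply_delta ap dest: injD)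
    next
      case False
      then have "y \<notin> g ` s ` B" for B by (auto simp: g)
      then show ?thesis using False
        by (auto simp: blinfun.add_left unit_op_apply ell2_apply_delta ell2_apply_shift_outside)
    qed
  qed
  have "norm (blinfun_apply (\<Phi> (shift (s ` (A - {n})) g)) ?v) \<le> 2 * (c / 8)"
    unfolding shift(2)
  proof (rule countably_subadditiveD[OF A(2)])
    show "(\<lambda>m. c / 8 * (1 / 2) ^ m) sums (2 * (c / 8))"
      using sums_mult[OF geometric_sums[of "1 / 2 :: real"], of "c / 8"] by (simp add: mult.commute)
  qed (use st(7) \<open>c > 0\<close> in auto)
  then have 1: "cmod (cinner (\<Phi> (shift (s ` (A - {n})) g) ?v) ?w) \<le> c / 4"
    using cmod_ell2_apply_le[of "\<Phi> (shift (s ` (A - {n})) g) ?v" "f (t n)"] by simp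
  have fY: "f (s n) \<in> Y" "f (t n) \<in> Y" using f(1) sP by blast+
  have "cinner (blinfun_apply b ?v) ?w = 0"
    using \<rho>[OF fY] st(6)[of n] n(2) by simp
  then have "cmod (cinner (\<Phi> (shift (s ` A) g) ?v) ?w)
      = cmod (cinner (blinfun_apply (\<Phi> (shift (s ` A) g) - b) ?v) ?w)"
    by (simp add: blinfun.diff_left)
  also have "\<dots> \<le> norm (blinfun_apply (\<Phi> (shift (s ` A) g) - b) ?v)"
    using cmod_ell2_apply_le by simp
  also have "\<dots> \<le> norm (\<Phi> (shift (s ` A) g) - b) * norm ?v" by (rule norm_blinfun)
  finally have 2: "cmod (cinner (\<Phi> (shift (s ` A) g) ?v) ?w) \<le> c / 4" using b(3) by simp
  have diff: "cinner (\<Phi> (unit_op (t n) (s n)) ?v) ?w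
      = cinner (\<Phi> (shift (s ` A) g) ?v) ?w - cinner (\<Phi> (shift (s ` (A - {n})) g) ?v) ?w"
    unfolding split Phi_add[OF unit_op_in(1)[OF sX(1) sX(2)] shift(1)] by (simp add: blinfun.add_left)
  have "c \<le> c / 4 + c / 4"
    using large[OF sP(1) sP(2), of n n, unfolded diff] 1 2
      norm_triangle_ineq4[of "cinner (\<Phi> (shift (s ` A) g) ?v) ?w" "cinner (\<Phi> (shift (s ` (A - {n})) g) ?v) ?w"]
    by linarith
  then show False using \<open>c > 0\<close> by simp
qed

text \<open>The colour of \<open>x\<close> consists of the member \<open>\<kappa> x\<close> of a finite \<open>\<delta>/2\<close>-net close to \<open>v x\<close> and of the index
  \<open>\<iota> x\<close> in the fibre of \<open>f\<close>. Equal \<open>\<kappa>\<close> gives \<open>\<parallel>v x - v x'\<parallel> \<le> \<delta>\<close>, hence by polarization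
  \<open>Re \<langle>v x, v x'\<rangle> \<ge> \<delta>\<^sup>2/2\<close>; equal \<open>\<iota>\<close> gives injectivity.\<close>

lemma ex_coarse_partition:
  assumes ghosts: "\<forall>Z\<subseteq>Y. sparse_space Z e \<longrightarrow> only_compact_ghost_projections Z e"
  shows "\<exists>k::nat. \<exists>P :: nat \<Rightarrow> 'a set. k \<ge> 1 \<and> (\<Union>n\<in>{1..k}. P n) = X \<and>
    disjoint_family_on P {1..k} \<and> (\<forall>n\<in>{1..k}. \<exists>f. coarse_map (P n) d Y e f \<and> inj_on f (P n))"
proof (cases "X = {}")
  case True
  then show ?thesis
    by (intro exI[of _ 1] exI[of _ "\<lambda>_. {}"]) (auto simp: disjoint_family_on_def coarse_map_def)
next
  case False
  then obtain x0 where x0: "x0 \<in> X" by blast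
  obtain \<delta> where \<delta>: "\<delta> > 0" "\<And>x. x \<in> X \<Longrightarrow> \<exists>y\<in>Y. \<delta> \<le> norm (blinfun_apply (E {x}) (delta y))"
    using uniform_lower_bound[OF ghosts] by blast
  then obtain f where f: "\<And>x. x \<in> X \<Longrightarrow> f x \<in> Y \<and> \<delta> \<le> norm (blinfun_apply (E {x}) (delta (f x)))"
    by metis
  define v where "v x = blinfun_apply (\<Phi> (unit_op x0 x)) (delta (f x))" for x
  have v_norm: "\<delta> \<le> norm (v x)" "norm (v x) \<le> 1" if "x \<in> X" for x
    using f[OF that] E_norm_le[of "{x}" "delta (f x)"] that by (simp_all add: v_def unit_op_in(2) x0)
  have v_range: "blinfun_apply (E {x0}) (v x) = v x" if "x \<in> X" for x
    using Phi_compose[OF unit_op_in(1)[OF x0 x0] unit_op_in(1)[OF that x0], of "delta (f x)"]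
    by (simp only: v_def E_def unit_op_compose unit_op_diag[symmetric])
  have v_entry: "cinner (v x) (v x') = cinner (blinfun_apply (\<Phi> (unit_op x' x)) (delta (f x))) (delta (f x'))"
    if "x \<in> X" "x' \<in> X" for x x'
    using Phi_compose[OF unit_op_in(1)[OF x0 that(2)] unit_op_in(1)[OF that(1) x0], of "delta (f x)"]
      cinner_Phi[OF unit_op_in(1)[OF x0 that(2)], of "v x" "delta (f x')"]
    by (simp add: v_def adj_unit_op unit_op_compose)
  obtain K where K: "finite K" "\<And>w. norm w \<le> 1 \<Longrightarrow> \<exists>k\<in>K. norm (blinfun_apply (E {x0}) w - k) < \<delta> / 2"
    using compact_op_finite_cover[OF E_singleton_compact[OF x0], of "\<delta> / 2"] \<delta>(1) by auto
  have "\<forall>x\<in>X. \<exists>k\<in>K. norm (v x - k) < \<delta> / 2" using K(2) v_norm(2) v_range by metis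
  then obtain \<kappa> where \<kappa>: "\<And>x. x \<in> X \<Longrightarrow> \<kappa> x \<in> K \<and> norm (v x - \<kappa> x) < \<delta> / 2" by metis
  have fibre: "finite {x \<in> X. f x = y} \<and> card {x \<in> X. f x = y} \<le> nat \<lfloor>1 / \<delta>\<^sup>2\<rfloor>" for y
  proof -
    have "{x \<in> X. f x = y} \<subseteq> {x \<in> X. \<delta> \<le> norm (blinfun_apply (E {x}) (delta y))}" using f by blast
    then show ?thesis using large_singletons_bounded[OF \<delta>(1), of y]
      by (meson card_mono finite_subset order_trans)
  qed
  obtain \<iota> :: "'a \<Rightarrow> nat" where \<iota>: "\<And>x. x \<in> X \<Longrightarrow> \<iota> x < nat \<lfloor>1 / \<delta>\<^sup>2\<rfloor>"
    "\<And>x x'. x \<in> X \<Longrightarrow> x' \<in> X \<Longrightarrow> f x = f x' \<Longrightarrow> \<iota> x = \<iota> x' \<Longrightarrow> x = x'"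
    using ex_fibre_index[OF fibre] by metis
  have "finite (K \<times> {..<nat \<lfloor>1 / \<delta>\<^sup>2\<rfloor>})" using K(1) by simp
  moreover have "(\<kappa> x, \<iota> x) \<in> K \<times> {..<nat \<lfloor>1 / \<delta>\<^sup>2\<rfloor>}" if "x \<in> X" for x
    using \<kappa>[OF that] \<iota>(1)[OF that] by simp
  ultimately obtain k :: nat and P :: "nat \<Rightarrow> 'a set" where kP: "k \<ge> 1" "(\<Union>n\<in>{1..k}. P n) = X"
    "disjoint_family_on P {1..k}" "\<And>n x y. x \<in> P n \<Longrightarrow> y \<in> P n \<Longrightarrow> (\<kappa> x, \<iota> x) = (\<kappa> y, \<iota> y)"
    using ex_partition_of_finite_colouring[of "K \<times> {..<nat \<lfloor>1 / \<delta>\<^sup>2\<rfloor>}" X "\<lambda>x. (\<kappa> x, \<iota> x)"] by metis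
  have "coarse_map (P n) d Y e f \<and> inj_on f (P n)" if n: "n \<in> {1..k}" for n
  proof -
    have PX: "P n \<subseteq> X" using kP(2) n by blast
    have inj: "inj_on f (P n)"
      by (rule inj_onI) (use kP(4) \<iota>(2) PX in blast)
    moreover have "coarse_map (P n) d Y e f"
    proof (rule coarse_if_large_entries[OF PX _ inj])
      show "f \<in> P n \<rightarrow> Y" using f PX by blast
      show "\<delta>\<^sup>2 / 2 > 0" using \<delta>(1) by simp
      fix x x' assume x: "x \<in> P n" "x' \<in> P n"
      then have X: "x \<in> X" "x' \<in> X" using PX by blast+
      have "norm (v x - v x') \<le> norm (v x - \<kappa> x) + norm (v x' - \<kappa> x)"
        using norm_triangle_ineq4[of "v x - \<kappa> x" "v x' - \<kappa> x"] by simp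
      also have "\<dots> \<le> \<delta>" using \<kappa>[OF X(1)] \<kappa>[OF X(2)] kP(4)[OF x] by simp
      finally have "(norm (v x - v x'))\<^sup>2 \<le> \<delta>\<^sup>2" by (simp add: power_mono)
      moreover have "(norm (v x - v x'))\<^sup>2 = (norm (v x))\<^sup>2 + (norm (v x'))\<^sup>2 - 2 * inner (v x) (v x')"
        by (simp add: power2_norm_eq_inner inner_diff_left inner_diff_right inner_commute)
      moreover have "\<delta>\<^sup>2 \<le> (norm (v x))\<^sup>2" "\<delta>\<^sup>2 \<le> (norm (v x'))\<^sup>2"
        using v_norm(1) X \<delta>(1) by (simp_all add: power_mono)
      ultimately have "\<delta>\<^sup>2 / 2 \<le> inner (v x) (v x')" by linarith
      also have "\<dots> \<le> cmod (cinner (v x) (v x'))"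
        unfolding inner_eq_Re_cinner by (rule complex_Re_le_cmod)
      finally show "\<delta>\<^sup>2 / 2 \<le> cmod (cinner (blinfun_apply (\<Phi> (unit_op x' x)) (delta (f x))) (delta (f x')))"
        unfolding v_entry[OF X] .
    qed
    ultimately show ?thesis by blast
  qed
  then show ?thesis using kP(1-3) by blast
qed

end

section \<open>Embeddings of uniform Roe algebras\<close>

theorem theorem1p2:
  fixes X :: "'a set" and d :: "'a \<Rightarrow> 'a \<Rightarrow> real"
    and Y :: "'b set" and e :: "'b \<Rightarrow> 'b \<Rightarrow> real"
  assumes "Metric_space X d" and "unif_locally_finite X d"
    and "Metric_space Y e" and "unif_locally_finite Y e"
    and "\<forall>Z\<subseteq>Y. sparse_space Z e \<longrightarrow> only_compact_ghost_projections Z e"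
  shows "((\<exists>f. coarse_map X d Y e f \<and> inj_on f X) \<longrightarrow> (\<exists>\<Phi>. Roe_embedding X d Y e \<Phi>)) \<and>
    ((\<exists>\<Phi>. Roe_embedding X d Y e \<Phi> \<and> compact_preserving X d \<Phi>) \<longrightarrow>
      (\<exists>k::nat. \<exists>P :: nat \<Rightarrow> 'a set. k \<ge> 1 \<and> (\<Union>n\<in>{1..k}. P n) = X \<and> disjoint_family_on P {1..k} \<and>
        (\<forall>n\<in>{1..k}. \<exists>f. coarse_map (P n) d Y e f \<and> inj_on f (P n))))"
proof (intro conjI impI; elim exE conjE)
  fix f assume "coarse_map X d Y e f" "inj_on f X"
  then show "\<exists>\<Phi>. Roe_embedding X d Y e \<Phi>" by (rule Roe_embedding_of_coarse_injection)
next
  fix \<Phi> assume "Roe_embedding X d Y e \<Phi>" "compact_preserving X d \<Phi>"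
  then interpret compact_Roe_embedding X d Y e \<Phi>
    by (rule compact_Roe_embedding.intro[OF assms(1-4)])
  show "\<exists>k::nat. \<exists>P. k \<ge> 1 \<and> (\<Union>n\<in>{1..k}. P n) = X \<and> disjoint_family_on P {1..k} \<and>
      (\<forall>n\<in>{1..k}. \<exists>f. coarse_map (P n) d Y e f \<and> inj_on f (P n))"
    by (rule ex_coarse_partition[OF assms(5)])
qed

end
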